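(* Let $k\geq 1$. With respect to the $\mathbb{F}_q[[t]]$-basis of $T_t(\rho_kC)$ given by the columns of $\rho_{[k]}(\omega)$, the Galois representation $\varrho_t:\mathrm{Gal}(K^{\mathrm{sep}}/K)\to\mathrm{GL}_{k+1}(\mathbb{F}_q[[t]])$ on the $t$-adic Tate module of $\rho_kC$ is the composition \[\mathrm{Gal}(K^{\mathrm{sep}}/K)\twoheadrightarrow\mathbb{F}_q[[t]]^\times\to\mathrm{GL}_{k+1}(\mathbb{F}_q[[t]]),\qquad \gamma\mapsto a_\gamma\mapsto\rho_{[k]}(a_\gamma)=\begin{pmatrix} a_\gamma & \partial^{(1)}(a_\gamma)&\cdots&\partial^{(k)}(a_\gamma)\\ 0& a_\gamma&\ddots&\vdots\\ \vdots&\ddots&\ddots&\partial^{(1)}(a_\gamma)\\ 0&\cdots&0&a_\gamma\end{pmatrix}.\]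
   Context: $K=\mathbb{F}_q(\theta)$, $\mathbb{C}_\infty$ the completion of an algebraic closure of $\mathbb{F}_q((1/\theta))$ ($|\theta|=q$), $K^{\mathrm{sep}}\subset\mathbb{C}_\infty$ a separable closure of $K$. Hyperderivatives: $\partial^{(n)}(\sum_i x_it^i)=\sum_i\binom{i}{n}x_it^{i-n}$ (binomial coefficients mod $p=\mathrm{char}\,\mathbb{F}_q$); $\rho_{[k]}(f)$ is the $(k+1)\times(k+1)$ upper triangular matrix with $(i,j)$-entry $\partial^{(j-i)}(f)$ for $j\geq i$. $\omega(t)=(-\theta)^{1/(q-1)}\prod_{i\geq0}(1-t/\theta^{q^i})^{-1}\in\mathbb{C}_\infty[[t]]$ is the Anderson–Thakur function; for $\gamma\in\mathrm{Gal}(K^{\mathrm{sep}}/K)$, acting coefficientwise on power series in $t$, one has $\gamma(\omega)=a_\gamma\omega$ for a unique $a_\gamma\in\mathbb{F}_q[[t]]^\times$, and $\gamma\mapsto a_\gamma$ is a surjective homomorphism onto $\mathbb{F}_q[[t]]^\times$ (the Galois representation on the $t$-adic Tate module of the Carlitz module). $\rho_kC$ is $\mathbb{G}_a^{k+1}$ over $K$ with $\mathbb{F}_q[t]$-action $\Phi_t(x)=Nx+x^{(q)}$, $N$ having $\theta$ on the diagonal, $-1$ on the superdiagonal, $0$ elsewhere, $x^{(q)}$ the coordinatewise $q$-th power. Its $t$-adic Tate module is $T_t(\rho_kC)=\varprojlim_n\rho_kC[t^{n+1}]$ with its natural Galois action; a compatible system $(e_n)_{n\geq0}$ of $t^{n+1}$-torsion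 points is identified with the series $\sum_n e_nt^n\in(\mathbb{C}_\infty[[t]])^{k+1}$, and under this identification the columns of $\rho_{[k]}(\omega)$ form an $\mathbb{F}_q[[t]]$-basis of $T_t(\rho_kC)$; Galois acts coefficientwise. *)

theory Defs
  imports
    "HOL-Analysis.Abstract_Metric_Spaces"
    "HOL-Algebra.Algebraic_Closure_Type"
    "HOL-Algebra.Bij"
    "HOL-Algebra.Subrings"
    "Jordan_Normal_Form.Matrix"
begin

text \<open>
  Conventions. The finite field with \<open>q\<close> elements is a finite type \<open>'f\<close> of class \<open>field\<close>, with
  \<open>q = CARD('f)\<close>. The field of Laurent series in \<open>1/\<theta>\<close> is the type \<open>'f fls\<close>, so \<open>fls_X\<close> is \<open>1/\<theta>\<close> and
  \<open>fls_X_inv\<close> is \<open>\<theta>\<close>. The field \<open>\<complex>\<^sub>\<infinity>\<close> is an arbitrary completion \<open>'c\<close> of the algebraic closure of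
  \<open>'f fls\<close>, given by the embedding \<open>j\<close> of the algebraic closure and the absolute value \<open>v\<close>.
\<close>

definition abs_dist :: "('c::ab_group_add \<Rightarrow> real) \<Rightarrow> 'c \<Rightarrow> 'c \<Rightarrow> real" where
  "abs_dist v x y = v (x - y)"

definition nonarch_absolute_value :: "('c::field \<Rightarrow> real) \<Rightarrow> bool" where
  "nonarch_absolute_value v \<longleftrightarrow>
     (\<forall>x. v x \<ge> 0) \<and> (\<forall>x. v x = 0 \<longleftrightarrow> x = 0) \<and>
     (\<forall>x y. v (x * y) = v x * v y) \<and> (\<forall>x y. v (x + y) \<le> max (v x) (v y))"

definition is_C_infinity ::
  "('f::{finite,field} fls alg_closure \<Rightarrow> 'c::field) \<Rightarrow> ('c \<Rightarrow> real) \<Rightarrow> bool" where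
  "is_C_infinity j v \<longleftrightarrow>
     field_hom j \<and>
     nonarch_absolute_value v \<and>
     (\<forall>f. f \<noteq> 0 \<longrightarrow> v (j (to_ac f)) = real CARD('f) powi (- fls_subdegree f)) \<and>
     Metric_space.mcomplete UNIV (abs_dist v) \<and>
     Metric_space.mtopology UNIV (abs_dist v) closure_of (range j) = UNIV"

definition theta :: "('f::{finite,field} fls alg_closure \<Rightarrow> 'c::field) \<Rightarrow> 'c" where
  "theta j = j (to_ac fls_X_inv)"

definition Fq :: "('f::{finite,field} fls alg_closure \<Rightarrow> 'c::field) \<Rightarrow> 'f \<Rightarrow> 'c" where
  "Fq j c = j (to_ac (fls_const c))"

definition Fq_fps :: "('f::{finite,field} fls alg_closure \<Rightarrow> 'c::field) \<Rightarrow> 'f fps \<Rightarrow> 'c fps" where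
  "Fq_fps j a = Abs_fps (\<lambda>n. Fq j (fps_nth a n))"

definition K_field :: "('f::{finite,field} fls alg_closure \<Rightarrow> 'c::field) \<Rightarrow> 'c set" where
  "K_field j = {poly (map_poly (Fq j) p) (theta j) / poly (map_poly (Fq j) r) (theta j) | p r. r \<noteq> 0}"


definition separable_poly_over :: "'c::field set \<Rightarrow> 'c poly \<Rightarrow> bool" where
  "separable_poly_over S f \<longleftrightarrow> (\<forall>i. Polynomial.coeff f i \<in> S) \<and> coprime f (pderiv f)"

definition separable_closure :: "'c::field set \<Rightarrow> 'c set \<Rightarrow> bool" where
  "separable_closure K L \<longleftrightarrow>
     subfield L (ring_of_type_algebra :: 'c ring) \<and> K \<subseteq> L \<and>
     (\<forall>x\<in>L. \<exists>f. separable_poly_over K f \<and> poly f x = 0) \<and>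
     (\<forall>f. separable_poly_over L f \<and> Polynomial.degree f > 0 \<longrightarrow> (\<exists>x\<in>L. poly f x = 0))"

text \<open>
  As in \<^const>\<open>BijGroup\<close>, automorphisms of \<open>L\<close> are functions that are \<open>undefined\<close> outside \<open>L\<close>.
\<close>

definition Gal :: "'c::field set \<Rightarrow> 'c set \<Rightarrow> ('c \<Rightarrow> 'c) monoid" where
  "Gal L K = (BijGroup L)\<lparr>carrier :=
     {\<gamma> \<in> Bij L.
        (\<forall>x\<in>L. \<forall>y\<in>L. \<gamma> (x + y) = \<gamma> x + \<gamma> y \<and> \<gamma> (x * y) = \<gamma> x * \<gamma> y) \<and>
        (\<forall>x\<in>K. \<gamma> x = x)}\<rparr>"


definition hyperderiv :: "nat \<Rightarrow> 'a::comm_ring_1 fps \<Rightarrow> 'a fps" where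
  "hyperderiv n f = Abs_fps (\<lambda>i. of_nat ((i + n) choose n) * fps_nth f (i + n))"

definition rho_mat :: "nat \<Rightarrow> 'a::comm_ring_1 fps \<Rightarrow> 'a fps mat" where
  "rho_mat k f = mat (k + 1) (k + 1) (\<lambda>(i, l). if i \<le> l then hyperderiv (l - i) f else 0)"

text \<open>
  The infinite product converges coefficientwise for \<open>v\<close>; the argument \<open>lam\<close> is the chosen
  \<open>(q - 1)\<close>-th root of \<open>-\<theta>\<close>.
\<close>

definition omega ::
  "('f::{finite,field} fls alg_closure \<Rightarrow> 'c::field) \<Rightarrow> ('c \<Rightarrow> real) \<Rightarrow> 'c \<Rightarrow> 'c fps" where
  "omega j v lam = fps_const lam * Abs_fps (\<lambda>n. THE l.
     limitin (Metric_space.mtopology UNIV (abs_dist v))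
       (\<lambda>m. fps_nth (\<Prod>i<m. inverse (1 - fps_const (1 / theta j ^ (CARD('f) ^ i)) * fps_X)) n)
       l sequentially)"

definition gal_fps :: "('c \<Rightarrow> 'c) \<Rightarrow> 'c fps \<Rightarrow> 'c fps" where
  "gal_fps \<gamma> f = Abs_fps (\<lambda>n. \<gamma> (fps_nth f n))"

definition galois_char ::
  "('f::{finite,field} fls alg_closure \<Rightarrow> 'c::field) \<Rightarrow> ('c \<Rightarrow> real) \<Rightarrow> 'c \<Rightarrow> ('c \<Rightarrow> 'c) \<Rightarrow> 'f fps" where
  "galois_char j v lam \<gamma> =
     (THE a. a dvd 1 \<and> gal_fps \<gamma> (omega j v lam) = Fq_fps j a * omega j v lam)"

definition fps_units :: "'f::field fps monoid" where
  "fps_units = units_of (ring_of_type_algebra :: 'f fps ring)"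

definition GL_fps :: "nat \<Rightarrow> 'f::field fps mat monoid" where
  "GL_fps n = units_of (ring_mat TYPE('f fps) n ())"


definition N_mat :: "('f::{finite,field} fls alg_closure \<Rightarrow> 'c::field) \<Rightarrow> nat \<Rightarrow> 'c mat" where
  "N_mat j k = mat (k + 1) (k + 1)
     (\<lambda>(i, l). if i = l then theta j else if l = Suc i then -1 else 0)"

definition Phi_t ::
  "('f::{finite,field} fls alg_closure \<Rightarrow> 'c::field) \<Rightarrow> nat \<Rightarrow> 'c vec \<Rightarrow> 'c vec" where
  "Phi_t j k x = N_mat j k *\<^sub>v x + map_vec (\<lambda>y. y ^ CARD('f)) x"

definition Phi ::
  "('f::{finite,field} fls alg_closure \<Rightarrow> 'c::field) \<Rightarrow> nat \<Rightarrow> 'f poly \<Rightarrow> 'c vec \<Rightarrow> 'c vec" where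
  "Phi j k a x = vec (k + 1)
     (\<lambda>i. \<Sum>m\<le>Polynomial.degree a. Fq j (Polynomial.coeff a m) * ((Phi_t j k ^^ m) x $ i))"

definition torsion ::
  "('f::{finite,field} fls alg_closure \<Rightarrow> 'c::field) \<Rightarrow> nat \<Rightarrow> 'f poly \<Rightarrow> 'c vec set" where
  "torsion j k a = {x \<in> carrier_vec (k + 1). Phi j k a x = 0\<^sub>v (k + 1)}"

definition tate_module ::
  "('f::{finite,field} fls alg_closure \<Rightarrow> 'c::field) \<Rightarrow> nat \<Rightarrow> (nat \<Rightarrow> 'c vec) set" where
  "tate_module j k =
     {e. \<forall>n. e n \<in> torsion j k (Polynomial.monom 1 (n + 1)) \<and>
             Phi j k (Polynomial.monom 1 1) (e (n + 1)) = e n}"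

text \<open>
  A power series \<open>a\<close> acts on the \<open>t\<^sup>n\<^sup>+\<^sup>1\<close>-torsion through \<open>a\<close> modulo \<open>t\<^sup>n\<^sup>+\<^sup>1\<close>.
\<close>

definition tate_smult ::
  "('f::{finite,field} fls alg_closure \<Rightarrow> 'c::field) \<Rightarrow> nat \<Rightarrow> 'f fps \<Rightarrow>
   (nat \<Rightarrow> 'c vec) \<Rightarrow> nat \<Rightarrow> 'c vec" where
  "tate_smult j k a e = (\<lambda>n. Phi j k (\<Sum>m\<le>n. Polynomial.monom (fps_nth a m) m) (e n))"

definition tate_lincomb ::
  "('f::{finite,field} fls alg_closure \<Rightarrow> 'c::field) \<Rightarrow> nat \<Rightarrow> (nat \<Rightarrow> nat \<Rightarrow> 'c vec) \<Rightarrow>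
   'f fps vec \<Rightarrow> nat \<Rightarrow> 'c vec" where
  "tate_lincomb j k b c =
     (\<lambda>n. vec (k + 1) (\<lambda>i. \<Sum>l<k + 1. tate_smult j k (c $ l) (b l) n $ i))"

definition is_tate_basis ::
  "('f::{finite,field} fls alg_closure \<Rightarrow> 'c::field) \<Rightarrow> nat \<Rightarrow> (nat \<Rightarrow> nat \<Rightarrow> 'c vec) \<Rightarrow> bool" where
  "is_tate_basis j k b \<longleftrightarrow>
     (\<forall>l<k + 1. b l \<in> tate_module j k) \<and>
     (\<forall>c\<in>carrier_vec (k + 1). tate_lincomb j k b c \<in> tate_module j k) \<and>
     (\<forall>e\<in>tate_module j k. \<exists>!c. c \<in> carrier_vec (k + 1) \<and> e = tate_lincomb j k b c)"

text \<open>
  The identification of the vector of power series \<open>\<Sum>\<^sub>n e\<^sub>n t\<^sup>n\<close> with the sequence \<open>e\<close>.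
\<close>

definition coeff_seq :: "'c fps vec \<Rightarrow> nat \<Rightarrow> 'c vec" where
  "coeff_seq w = (\<lambda>n. map_vec (\<lambda>f. fps_nth f n) w)"

definition omega_basis ::
  "('f::{finite,field} fls alg_closure \<Rightarrow> 'c::field) \<Rightarrow> ('c \<Rightarrow> real) \<Rightarrow> 'c \<Rightarrow> nat \<Rightarrow>
   nat \<Rightarrow> nat \<Rightarrow> 'c vec" where
  "omega_basis j v lam k l = coeff_seq (col (rho_mat k (omega j v lam)) l)"

definition gal_tate :: "('c \<Rightarrow> 'c) \<Rightarrow> (nat \<Rightarrow> 'c vec) \<Rightarrow> nat \<Rightarrow> 'c vec" where
  "gal_tate \<gamma> e = (\<lambda>n. map_vec \<gamma> (e n))"

text \<open>
  \<open>A\<close> is the matrix, in the basis \<open>b\<close>, of the action of \<open>\<gamma>\<close> on the Tate module; the images of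
  the basis vectors are the columns of \<open>A\<close>.
\<close>

definition represents ::
  "('f::{finite,field} fls alg_closure \<Rightarrow> 'c::field) \<Rightarrow> nat \<Rightarrow> (nat \<Rightarrow> nat \<Rightarrow> 'c vec) \<Rightarrow>
   ('c \<Rightarrow> 'c) \<Rightarrow> 'f fps mat \<Rightarrow> bool" where
  "represents j k b \<gamma> A \<longleftrightarrow> A \<in> carrier_mat (k + 1) (k + 1) \<and>
     (\<forall>c\<in>carrier_vec (k + 1).
        gal_tate \<gamma> (tate_lincomb j k b c) = tate_lincomb j k b (A *\<^sub>v c))"

definition tate_rep ::
  "('f::{finite,field} fls alg_closure \<Rightarrow> 'c::field) \<Rightarrow> nat \<Rightarrow> (nat \<Rightarrow> nat \<Rightarrow> 'c vec) \<Rightarrow>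
   ('c \<Rightarrow> 'c) \<Rightarrow> 'f fps mat" where
  "tate_rep j k b \<gamma> = (THE A. represents j k b \<gamma> A)"

end

theory Submission
  imports Defs "Subresultants.Resultant_Prelim"
begin

hide_const (open) Coset.order Module.smult UnivPoly.coeff
no_notation fps_nth (infixl "$" 75)
no_notation vec_nth (infixl "$" 90)

text \<open>
  The twist \<open>f \<mapsto> f\<^sup>(\<^sup>1\<^sup>)\<close> (coefficientwise \<open>q\<close>-th power) turns the torsion conditions into a
  difference equation: the Tate module consists of the vectors \<open>w\<close> of power series with
  \<open>w\<^sup>(\<^sup>1\<^sup>) = \<rho>(t - \<theta>) w\<close>, and \<open>\<omega>\<^sup>(\<^sup>1\<^sup>) = (t - \<theta>) \<omega>\<close>. Since \<open>\<rho>\<close> is multiplicative (Leibniz rule)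
  and commutes with the twist, \<open>\<rho>(\<omega>)\<inverse> w\<close> is fixed by the twist, hence has coefficients in
  \<open>\<bbbF>\<^sub>q\<close>; so the columns of \<open>\<rho>(\<omega>)\<close> are a basis. As \<open>\<gamma>\<close> fixes \<open>\<theta>\<close>, the series \<open>\<gamma>(\<omega>)\<close> solves the same
  equation as \<open>\<omega>\<close>, so \<open>\<gamma>(\<omega>) = a\<^sub>\<gamma> \<omega>\<close> and \<open>\<gamma>(\<rho>(\<omega>)) = \<rho>(\<omega>) \<rho>(a\<^sub>\<gamma>)\<close>.

  For surjectivity, the \<open>n\<close>-th coefficients of \<open>\<omega>\<close> and of \<open>u \<omega>\<close>, for a unit \<open>u\<close>, are roots of the same
  polynomial over \<open>\<bbbF>\<^sub>q[\<theta>]\<close>, which is Eisenstein at \<open>\<theta>\<close>. They therefore satisfy the same algebraic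
  relations over \<open>K\<close>, and the resulting partial automorphism extends to the separable closure
  by Zorn's lemma.
\<close>

section \<open>Finite fields, hyperderivatives and the matrices \<open>\<rho>\<close>\<close>

text \<open>Multiplication by a nonzero \<open>x\<close> permutes the nonzero elements, so their
  product equals x^(q-1) times itself.\<close>

lemma finite_field_power_card:
  fixes x :: "'f::{finite,field}"
  shows "x ^ CARD('f) = x"
proof (cases "x = 0")
  case False
  have "(\<Prod>y\<in>UNIV-{0}. y) = (\<Prod>y\<in>UNIV-{0}. x * y)"
    by (rule prod.reindex_bij_witness[of _ "\<lambda>y. x * y" "\<lambda>y. y / x"]) (use False in auto)
  also have "\<dots> = x ^ (CARD('f) - 1) * (\<Prod>y\<in>UNIV-{0}. y)"
    by (simp add: prod.distrib card_Diff_singleton)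
  finally have "x ^ (CARD('f) - 1) = 1"
    by (simp add: prod_zero_iff)
  then have "x ^ Suc (CARD('f) - 1) = x"
    unfolding power_Suc by simp
  moreover have "Suc (CARD('f) - 1) = CARD('f)"
    using zero_less_card_finite[where 'a='f] by simp
  ultimately show ?thesis
    by simp
qed simp

lemma card_field_ge_2: "CARD('f::{finite,field}) \<ge> 2"
proof -
  have "card {0, 1::'f} \<le> CARD('f)"
    by (intro card_mono) auto
  then show ?thesis
    by simp
qed

text \<open>Translation by 1 permutes the field, so the sum of all elements does not change when q
  ones are added to it.\<close>

lemma of_nat_card_field_eq_0: "of_nat CARD('f) = (0::'f::{finite,field})"
proof -
  have "(\<Sum>y\<in>UNIV. y) = (\<Sum>y\<in>UNIV. y + (1::'f))"
    by (rule sum.reindex_bij_witness[of _ "\<lambda>y. y + 1" "\<lambda>y. y - 1"]) auto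
  then show ?thesis
    by (simp add: sum.distrib)
qed

text \<open>
  The polynomial \<open>(X + 1)\<^sup>q - X\<^sup>q - 1\<close> has degree less than \<open>q\<close> and vanishes on the whole field.
\<close>

lemma of_nat_choose_card_field:
  assumes "0 < i" "i < CARD('f)"
  shows "of_nat (CARD('f) choose i) = (0::'f::{finite,field})"
proof -
  let ?q = "CARD('f)"
  define p :: "'f poly" where "p = (\<Sum>i\<in>{0<..<?q}. monom (of_nat (?q choose i)) i)"
  have "poly p x = 0" for x
  proof -
    have "(x + 1) ^ ?q = (\<Sum>i\<le>?q. of_nat (?q choose i) * x ^ i)"
      by (simp add: binomial_ring)
    also have "{..?q} = insert 0 (insert ?q {0<..<?q})"
      by auto
    also have "(\<Sum>i\<in>\<dots>. of_nat (?q choose i) * x ^ i) = 1 + x ^ ?q + poly p x"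
      by (simp add: p_def poly_sum poly_monom)
    finally show ?thesis
      by (simp add: finite_field_power_card)
  qed
  moreover have "degree p < ?q"
    unfolding p_def using card_field_ge_2[where ?'f='f]
    by (intro degree_lessI) (auto simp: coeff_sum)
  ultimately have "p = 0"
    using card_poly_roots_bound[of p] by force
  then have "Polynomial.coeff p i = 0"
    by simp
  then show ?thesis
    using assms by (simp add: p_def coeff_sum)
qed

text \<open>Galois automorphisms behave well only on the separable closure, so homomorphisms are
  taken on a subring \<open>S\<close>. The q-power map, the embedding of F_q, the identity of
  \<open>L\<close> and every \<open>\<gamma>\<close> are instances, and so is each coefficientwise
  extension to power series.\<close>

locale ring_hom_on =
  fixes S :: "'a::comm_ring_1 set" and h :: "'a \<Rightarrow> 'b::comm_ring_1"
  assumes zero_mem [simp]: "0 \<in> S"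
    and one_mem [simp]: "1 \<in> S"
    and add_mem [intro]: "\<And>x y. x \<in> S \<Longrightarrow> y \<in> S \<Longrightarrow> x + y \<in> S"
    and uminus_mem [intro]: "\<And>x. x \<in> S \<Longrightarrow> - x \<in> S"
    and mult_mem [intro]: "\<And>x y. x \<in> S \<Longrightarrow> y \<in> S \<Longrightarrow> x * y \<in> S"
    and add: "\<And>x y. x \<in> S \<Longrightarrow> y \<in> S \<Longrightarrow> h (x + y) = h x + h y"
    and mult: "\<And>x y. x \<in> S \<Longrightarrow> y \<in> S \<Longrightarrow> h (x * y) = h x * h y"
    and one [simp]: "h 1 = 1"
begin

lemma zero [simp]: "h 0 = 0"
  using add[of 0 0] by simp

lemma sum_mem: "(\<And>i. i \<in> I \<Longrightarrow> f i \<in> S) \<Longrightarrow> sum f I \<in> S"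
  by (induction I rule: infinite_finite_induct) auto

lemma sum: "(\<And>i. i \<in> I \<Longrightarrow> f i \<in> S) \<Longrightarrow> h (sum f I) = (\<Sum>i\<in>I. h (f i))"
  by (induction I rule: infinite_finite_induct) (auto simp: add sum_mem)

lemma of_nat_mem [simp]: "of_nat n \<in> S"
  by (induction n) auto

lemma of_nat [simp]: "h (of_nat n) = of_nat n"
  by (induction n) (auto simp: add)

lemma power_mem: "x \<in> S \<Longrightarrow> x ^ n \<in> S"
  by (induction n) auto

lemma power: "x \<in> S \<Longrightarrow> h (x ^ n) = h x ^ n"
  by (induction n) (auto simp: mult power_mem)

lemma uminus: "x \<in> S \<Longrightarrow> h (- x) = - h x"
  using add[of x "-x"] by (simp add: uminus_mem eq_neg_iff_add_eq_0 add.commute)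

definition fps_over :: "'a fps set" where
  "fps_over = {f. \<forall>n. fps_nth f n \<in> S}"

definition fps_map :: "'a fps \<Rightarrow> 'b fps" where
  "fps_map f = Abs_fps (\<lambda>n. h (fps_nth f n))"

lemma fps_map_nth [simp]: "fps_nth (fps_map f) n = h (fps_nth f n)"
  by (simp add: fps_map_def)

lemma fps_over_nth: "f \<in> fps_over \<Longrightarrow> fps_nth f n \<in> S"
  by (simp add: fps_over_def)

lemma ring_hom_on_fps: "ring_hom_on fps_over fps_map"
proof unfold_locales
  fix f g assume "f \<in> fps_over" "g \<in> fps_over"
  then have fg: "fps_nth f n \<in> S" "fps_nth g n \<in> S" for n
    by (simp_all add: fps_over_def)
  then show "fps_map (f * g) = fps_map f * fps_map g"
    by (auto simp: fps_eq_iff fps_mult_nth sum mult mult_mem cong: sum.cong)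
qed (auto simp: fps_over_def fps_eq_iff fps_mult_nth add intro!: sum_mem)

lemmas fps_map_mult = ring_hom_on.mult[OF ring_hom_on_fps]
  and fps_over_mult = ring_hom_on.mult_mem[OF ring_hom_on_fps]

lemma hyperderiv_mem: "f \<in> fps_over \<Longrightarrow> hyperderiv n f \<in> fps_over"
  by (auto simp: fps_over_def hyperderiv_def)

lemma fps_map_hyperderiv: "f \<in> fps_over \<Longrightarrow> fps_map (hyperderiv n f) = hyperderiv n (fps_map f)"
  by (auto simp: fps_over_def hyperderiv_def fps_eq_iff mult)

lemma rho_mat_mem:
  "f \<in> fps_over \<Longrightarrow> i < Suc k \<Longrightarrow> l < Suc k \<Longrightarrow> rho_mat k f $$ (i, l) \<in> fps_over"
  using hyperderiv_mem by (auto simp: rho_mat_def fps_over_def)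

lemma map_rho_mat:
  assumes "f \<in> fps_over"
  shows "map_mat fps_map (rho_mat k f) = rho_mat k (fps_map f)"
  by (rule eq_matI)
     (auto simp: rho_mat_def fps_map_hyperderiv assms ring_hom_on.zero[OF ring_hom_on_fps])

lemma map_mult_mat_vec:
  assumes "A \<in> carrier_mat m n" "x \<in> carrier_vec n"
    and "\<And>i l. i < m \<Longrightarrow> l < n \<Longrightarrow> A $$ (i, l) \<in> S" "\<And>l. l < n \<Longrightarrow> x $ l \<in> S"
  shows "map_vec h (A *\<^sub>v x) = map_mat h A *\<^sub>v map_vec h x"
proof (rule eq_vecI)
  fix i assume "i < dim_vec (map_mat h A *\<^sub>v map_vec h x)"
  then have i: "i < m"
    using assms(1) by simp
  have "h (\<Sum>l = 0..<n. A $$ (i, l) * x $ l) = (\<Sum>l = 0..<n. h (A $$ (i, l)) * h (x $ l))"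
    using assms(3,4) i by (subst sum) (auto intro!: sum.cong mult)
  then show "map_vec h (A *\<^sub>v x) $ i = (map_mat h A *\<^sub>v map_vec h x) $ i"
    using assms(1,2) i by (simp add: scalar_prod_def)
qed (use assms(1) in simp)

end

section \<open>Hyperderivatives and multiplicativity of \<open>rho_mat\<close>\<close>

lemma fps_nth_hyperderiv: "fps_nth (hyperderiv n f) i = of_nat ((i + n) choose n) * fps_nth f (i + n)"
  by (simp add: hyperderiv_def)

lemma hyperderiv_0 [simp]: "hyperderiv 0 f = f"
  by (simp add: fps_eq_iff fps_nth_hyperderiv)

text \<open>A product f_a g_b with a + b = n + m contributes to the coefficient of t^m on both
  sides, and its multiplicities agree by Vandermonde's identity.\<close>

lemma hyperderiv_mult:
  "hyperderiv n (f * g) = (\<Sum>i\<le>n. hyperderiv i f * hyperderiv (n - i) g)"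
proof (rule fps_ext)
  fix m
  \<comment> \<open>\<open>F a b i\<close> is the contribution of f_a g_b to the i-th summand. The
    binomials vanish unless i <= a and n - i <= b, so extending the range of \<open>a\<close> adds
    only zeros.\<close>
  define F where "F a b i = of_nat ((a choose i) * (b choose (n - i))) * (fps_nth f a * fps_nth g b)"
    for a b i
  have inner: "fps_nth (hyperderiv i f * hyperderiv (n - i) g) m = (\<Sum>a\<le>n+m. F a (n + m - a) i)"
    if "i \<le> n" for i
  proof -
    have "fps_nth (hyperderiv i f * hyperderiv (n - i) g) m =
        (\<Sum>l=0..m. F (l + i) (n + m - (l + i)) i)"
      using that by (auto simp: fps_mult_nth fps_nth_hyperderiv F_def mult_ac add.commute[of m n] intro!: sum.cong)
    also have "\<dots> = (\<Sum>a\<in>{i..m+i}. F a (n + m - a) i)"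
      by (rule sum.reindex_bij_witness[of _ "\<lambda>a. a - i" "\<lambda>l. l + i"]) auto
    also have "\<dots> = (\<Sum>a\<le>n+m. F a (n + m - a) i)"
      using that by (intro sum.mono_neutral_left) (auto simp: F_def not_le binomial_eq_0)
    finally show ?thesis .
  qed
  have "fps_nth (\<Sum>i\<le>n. hyperderiv i f * hyperderiv (n - i) g) m =
      (\<Sum>i\<le>n. \<Sum>a\<le>n+m. F a (n + m - a) i)"
    by (simp add: fps_sum_nth inner)
  also have "\<dots> = (\<Sum>a\<le>n+m. \<Sum>i\<le>n. F a (n + m - a) i)"
    by (rule sum.swap)
  also have "\<dots> = (\<Sum>a\<le>n+m. of_nat ((n + m) choose n) * (fps_nth f a * fps_nth g (n + m - a)))"
  proof (rule sum.cong)
    fix a assume "a \<in> {..n+m}"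
    then have "(\<Sum>i\<le>n. (a choose i) * ((n + m - a) choose (n - i))) = (n + m) choose n"
      using vandermonde[of a "n + m - a" n] by simp
    then show "(\<Sum>i\<le>n. F a (n + m - a) i) =
        of_nat ((n + m) choose n) * (fps_nth f a * fps_nth g (n + m - a))"
      by (simp only: F_def sum_distrib_right[symmetric] of_nat_sum[symmetric])
  qed simp
  also have "\<dots> = fps_nth (hyperderiv n (f * g)) m"
    by (simp add: fps_nth_hyperderiv fps_mult_nth sum_distrib_left atLeast0AtMost add.commute)
  finally show "fps_nth (hyperderiv n (f * g)) m =
      fps_nth (\<Sum>i\<le>n. hyperderiv i f * hyperderiv (n - i) g) m" ..
qed

lemma hyperderiv_1: "hyperderiv n 1 = (if n = 0 then 1 else 0)"
  by (auto simp: fps_eq_iff fps_nth_hyperderiv)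

lemma rho_mat_carrier [simp, intro]: "rho_mat k f \<in> carrier_mat (Suc k) (Suc k)"
  by (simp add: rho_mat_def)

lemma rho_mat_dim [simp]: "dim_row (rho_mat k f) = Suc k" "dim_col (rho_mat k f) = Suc k"
  by (simp_all add: rho_mat_def)

lemma rho_mat_index:
  "i < Suc k \<Longrightarrow> l < Suc k \<Longrightarrow> rho_mat k f $$ (i, l) = (if i \<le> l then hyperderiv (l - i) f else 0)"
  by (simp add: rho_mat_def)

lemma rho_mat_1: "rho_mat k 1 = 1\<^sub>m (Suc k)"
  by (rule eq_matI) (auto simp: rho_mat_index hyperderiv_1)

text \<open>Entry (i, l) of the matrix product is a sum over i <= m <= l, which is the Leibniz rule
  for order l - i.\<close>

lemma rho_mat_mult: "rho_mat k (f * g) = rho_mat k f * rho_mat k g"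
proof (rule eq_matI)
  fix i l assume "i < dim_row (rho_mat k f * rho_mat k g)" "l < dim_col (rho_mat k f * rho_mat k g)"
  then have il: "i < Suc k" "l < Suc k"
    by simp_all
  let ?t = "\<lambda>m. (if i \<le> m then hyperderiv (m - i) f else 0) * (if m \<le> l then hyperderiv (l - m) g else 0)"
  have "(rho_mat k f * rho_mat k g) $$ (i, l) = (\<Sum>m<Suc k. ?t m)"
    using il by (simp add: scalar_prod_def rho_mat_index atLeast0LessThan del: sum.lessThan_Suc)
  also have "\<dots> = (\<Sum>m\<in>{i..l}. hyperderiv (m - i) f * hyperderiv (l - m) g)"
    using il by (intro sum.mono_neutral_cong_right) auto
  also have "\<dots> = (if i \<le> l then hyperderiv (l - i) (f * g) else 0)"
  proof (cases "i \<le> l")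
    case True
    have "(\<Sum>m\<in>{i..l}. hyperderiv (m - i) f * hyperderiv (l - m) g) =
        (\<Sum>m\<le>l-i. hyperderiv m f * hyperderiv (l - i - m) g)"
      using True by (intro sum.reindex_bij_witness[of _ "\<lambda>m. m + i" "\<lambda>m. m - i"]) auto
    then show ?thesis
      using True by (simp add: hyperderiv_mult)
  qed simp
  finally show "rho_mat k (f * g) $$ (i, l) = (rho_mat k f * rho_mat k g) $$ (i, l)"
    using il by (simp add: rho_mat_index)
qed (simp_all add: rho_mat_def)

lemma rho_mat_hom: "(rho_mat k :: 'f::field fps \<Rightarrow> 'f fps mat) \<in> hom fps_units (GL_fps (k + 1))"
proof -
  have "rho_mat k u * rho_mat k w = 1\<^sub>m (k + 1)" if "u * w = 1" for u w :: "'f fps"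
    using rho_mat_mult[of k u w] that by (simp add: rho_mat_1)
  then have "\<exists>B\<in>carrier_mat (k + 1) (k + 1).
      B * rho_mat k u = 1\<^sub>m (k + 1) \<and> rho_mat k u * B = 1\<^sub>m (k + 1)"
    if "w * u = 1" for u w :: "'f fps"
    using that mult.commute[of w u] by (intro bexI[of _ "rho_mat k w"]) auto
  then have "rho_mat k u \<in> carrier (GL_fps (k + 1))" if "u \<in> carrier fps_units" for u :: "'f fps"
    using that unfolding GL_fps_def fps_units_def units_of_def Units_def
    by (auto simp: ring_of_type_algebra_def ring_mat_def)
  then show ?thesis
    by (simp add: hom_def GL_fps_def fps_units_def units_of_def ring_of_type_algebra_def
        ring_mat_def rho_mat_mult)
qed

lemma fps_units_carrier: "u \<in> carrier fps_units \<longleftrightarrow> u dvd 1"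
proof -
  have "u \<in> carrier fps_units \<longleftrightarrow> (\<exists>w. w * u = 1 \<and> u * w = 1)"
    by (simp add: fps_units_def units_of_def Units_def ring_of_type_algebra_def)
  also have "\<dots> \<longleftrightarrow> u dvd 1"
    by (metis dvd_def mult.commute)
  finally show ?thesis .
qed

lemma fps_units_mult: "u \<otimes>\<^bsub>fps_units\<^esub> w = u * w"
  by (simp add: fps_units_def units_of_def ring_of_type_algebra_def)

section \<open>Extending partial automorphisms of a separable closure\<close>

text \<open>
  A partial isomorphism is encoded as its graph, a subring of \<open>L \<times> L\<close>. This makes domain and
  range symmetric, so that surjectivity of an automorphism needs no separate argument.
\<close>

definition partial_iso :: "'c::field set \<Rightarrow> ('c \<times> 'c) set \<Rightarrow> bool" where
  "partial_iso L R \<longleftrightarrow> R \<subseteq> L \<times> L \<and> (1, 1) \<in> R \<and>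
     (\<forall>x y. (x, y) \<in> R \<longrightarrow> (- x, - y) \<in> R \<and> (x = 0 \<longleftrightarrow> y = 0)) \<and>
     (\<forall>x y z w. (x, y) \<in> R \<longrightarrow> (z, w) \<in> R \<longrightarrow> (x + z, y + w) \<in> R \<and> (x * z, y * w) \<in> R)"

definition max_partial_iso :: "'c::field set \<Rightarrow> ('c \<times> 'c) set \<Rightarrow> bool" where
  "max_partial_iso L R \<longleftrightarrow> partial_iso L R \<and> (\<forall>R'. partial_iso L R' \<longrightarrow> R \<subseteq> R' \<longrightarrow> R' = R)"

lemma partial_iso_converse: "partial_iso L R \<Longrightarrow> partial_iso L (R\<inverse>)"
  unfolding partial_iso_def by fast

lemma max_partial_iso_converse:
  assumes "max_partial_iso L R"
  shows "max_partial_iso L (R\<inverse>)"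
  unfolding max_partial_iso_def
proof (intro conjI allI impI)
  show "partial_iso L (R\<inverse>)"
    using assms partial_iso_converse by (auto simp: max_partial_iso_def)
  fix R' assume "partial_iso L R'" "R\<inverse> \<subseteq> R'"
  then have "partial_iso L (R'\<inverse>)" "R \<subseteq> R'\<inverse>"
    by (auto intro: partial_iso_converse)
  then have "R'\<inverse> = R"
    using assms by (simp add: max_partial_iso_def)
  then show "R' = R\<inverse>"
    by auto
qed

text \<open>Zorn's lemma. In the union of a chain any two pairs lie in a common member, which gives
  closure under sums and products.\<close>

lemma max_partial_iso_exists:
  assumes "partial_iso L R\<^sub>0"
  obtains R where "max_partial_iso L R" "R\<^sub>0 \<subseteq> R"
proof -
  let ?A = "{R. partial_iso L R \<and> R\<^sub>0 \<subseteq> R}"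
  have "\<exists>R\<in>?A. \<forall>R'\<in>?A. R \<subseteq> R' \<longrightarrow> R' = R"
  proof (rule subset_Zorn_nonempty)
    show "?A \<noteq> {}"
      using assms by auto
  next
    fix C assume C: "C \<noteq> {}" "subset.chain ?A C"
    have C_iso: "partial_iso L R" "R\<^sub>0 \<subseteq> R" if "R \<in> C" for R
      using C(2) that by (auto simp: subset_chain_def)
    have C_pair: "\<exists>R\<in>C. p \<in> R \<and> p' \<in> R" if "p \<in> \<Union>C" "p' \<in> \<Union>C" for p p'
      using C(2) that unfolding subset_chain_def by blast
    have "partial_iso L (\<Union>C)"
      unfolding partial_iso_def
    proof (intro conjI allI impI)
      show "\<Union>C \<subseteq> L \<times> L" "(1, 1) \<in> \<Union>C"
        using C_iso C(1) unfolding partial_iso_def by blast+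
      show "(- x, - y) \<in> \<Union>C" if "(x, y) \<in> \<Union>C" for x y
        using C_iso that unfolding partial_iso_def by blast
      show "x = 0 \<longleftrightarrow> y = 0" if "(x, y) \<in> \<Union>C" for x y
        using C_iso that unfolding partial_iso_def by blast
      fix x y z w assume "(x, y) \<in> \<Union>C" "(z, w) \<in> \<Union>C"
      then obtain R where R: "R \<in> C" "(x, y) \<in> R" "(z, w) \<in> R"
        using C_pair by blast
      then show "(x + z, y + w) \<in> \<Union>C" "(x * z, y * w) \<in> \<Union>C"
        using C_iso[OF R(1)] unfolding partial_iso_def by blast+
    qed
    then show "\<Union>C \<in> ?A"
      using C(1) C_iso by auto
  qed
  then show ?thesis
    using that unfolding max_partial_iso_def by (metis (no_types, lifting) mem_Collect_eq subset_trans)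
qed

locale sub_field =
  fixes L :: "'c::field set"
  assumes zero_mem [simp]: "0 \<in> L"
    and one_mem [simp]: "1 \<in> L"
    and add_mem: "\<And>x y. x \<in> L \<Longrightarrow> y \<in> L \<Longrightarrow> x + y \<in> L"
    and uminus_mem: "\<And>x. x \<in> L \<Longrightarrow> - x \<in> L"
    and mult_mem: "\<And>x y. x \<in> L \<Longrightarrow> y \<in> L \<Longrightarrow> x * y \<in> L"
    and inverse_mem: "\<And>x. x \<in> L \<Longrightarrow> inverse x \<in> L"
begin

lemma divide_mem: "x \<in> L \<Longrightarrow> y \<in> L \<Longrightarrow> x / y \<in> L"
  by (simp add: divide_inverse mult_mem inverse_mem)

lemma power_mem: "x \<in> L \<Longrightarrow> x ^ n \<in> L"
  by (induction n) (auto simp: mult_mem)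

lemma sum_mem: "(\<And>i. i \<in> I \<Longrightarrow> f i \<in> L) \<Longrightarrow> sum f I \<in> L"
  by (induction I rule: infinite_finite_induct) (auto simp: add_mem)

lemma poly_mem: "(\<And>i. Polynomial.coeff p i \<in> L) \<Longrightarrow> x \<in> L \<Longrightarrow> poly p x \<in> L"
  by (simp add: poly_altdef sum_mem mult_mem power_mem)

end

lemma sub_field_subfield:
  assumes "subfield L (ring_of_type_algebra :: 'c::field ring)"
  shows "sub_field L"
proof -
  let ?R = "ring_of_type_algebra :: 'c ring"
  interpret R: field ?R
    by (rule field_from_type_algebra)
  have sub: "subring L ?R"
    using assms by (rule subfieldE)
  have [simp]: "\<zero>\<^bsub>?R\<^esub> = 0" "\<one>\<^bsub>?R\<^esub> = 1" "x \<oplus>\<^bsub>?R\<^esub> y = x + y" "x \<otimes>\<^bsub>?R\<^esub> y = x * y"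
    and carrier: "carrier ?R = UNIV" for x y :: 'c
    by (simp_all add: ring_of_type_algebra_def)
  have minus: "\<ominus>\<^bsub>?R\<^esub> x = - x" for x
    using R.minus_equality[of "- x" x] by (simp add: carrier)
  have inv: "inv\<^bsub>?R\<^esub> x = inverse x" if "x \<noteq> 0" for x
    using R.comm_inv_char[of x "inverse x"] that by (simp add: carrier)
  show ?thesis
  proof
    show "0 \<in> L" "1 \<in> L"
      using subringE(2,3)[OF sub] by simp_all
    show "x + y \<in> L" "x * y \<in> L" if "x \<in> L" "y \<in> L" for x y
      using subringE(6,7)[OF sub that] by simp_all
    show "- x \<in> L" if "x \<in> L" for x
      using subringE(5)[OF sub that] by (simp add: minus)
    show "inverse x \<in> L" if "x \<in> L" for x
    proof (cases "x = 0")
      case False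
      then show ?thesis
        using R.subfield_m_inv(1)[OF assms, of x] that by (simp add: inv)
    qed (use that in simp)
  qed
qed

text \<open>Denominators are nonzero in both coordinates by the zero condition. Applied to a maximal
  partial isomorphism, this makes its domain and its range fields.\<close>

lemma partial_iso_localization:
  assumes "partial_iso L R" "sub_field L"
  shows "partial_iso L {(x / z, y / w) |x y z w. (x, y) \<in> R \<and> (z, w) \<in> R \<and> z \<noteq> 0}" (is "partial_iso L ?R'")
proof -
  have nz: "w \<noteq> 0" if "(z, w) \<in> R" "z \<noteq> 0" for z w
    using assms(1) that unfolding partial_iso_def by blast
  have R: "(1, 1) \<in> R" "\<And>x y. (x, y) \<in> R \<Longrightarrow> (- x, - y) \<in> R \<and> x \<in> L \<and> y \<in> L \<and> (x = 0 \<longleftrightarrow> y = 0)"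
    "\<And>x y z w. (x, y) \<in> R \<Longrightarrow> (z, w) \<in> R \<Longrightarrow> (x + z, y + w) \<in> R \<and> (x * z, y * w) \<in> R"
    using assms(1) unfolding partial_iso_def by blast+
  show ?thesis
    unfolding partial_iso_def
  proof (intro conjI allI impI)
    show "?R' \<subseteq> L \<times> L"
      using R(2) sub_field.divide_mem[OF assms(2)] by auto
    show "(1, 1) \<in> ?R'"
      using R(1) by (intro CollectI exI[of _ 1]) simp
    fix a b assume "(a, b) \<in> ?R'"
    then obtain x y z w where ab: "a = x / z" "b = y / w" "(x, y) \<in> R" "(z, w) \<in> R" "z \<noteq> 0"
      by blast
    then have "- a = (- x) / z" "- b = (- y) / w" "(- x, - y) \<in> R"
      using R(2) by simp_all
    then show "(- a, - b) \<in> ?R'"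
      using ab by blast
    show "a = 0 \<longleftrightarrow> b = 0"
      using ab R(2) nz by auto
    fix c d assume "(c, d) \<in> ?R'"
    then obtain x' y' z' w' where cd: "c = x' / z'" "d = y' / w'" "(x', y') \<in> R" "(z', w') \<in> R" "z' \<noteq> 0"
      by blast
    have "a + c = (x * z' + x' * z) / (z * z')" "b + d = (y * w' + y' * w) / (w * w')"
      using ab cd nz by (auto simp: field_simps)
    moreover have "(x * z' + x' * z, y * w' + y' * w) \<in> R" "(z * z', w * w') \<in> R" "z * z' \<noteq> 0"
      using ab cd R(3) by auto
    ultimately show "(a + c, b + d) \<in> ?R'"
      by blast
    have "a * c = (x * x') / (z * z')" "b * d = (y * y') / (w * w')"
      using ab cd by auto
    moreover have "(x * x', y * y') \<in> R"
      using ab cd R(3) by auto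
    ultimately show "(a * c, b * d) \<in> ?R'"
      using \<open>(z * z', w * w') \<in> R\<close> \<open>z * z' \<noteq> 0\<close> by blast
  qed
qed

text \<open>This is the coefficientwise image of a polynomial under the partial isomorphism; as a
  relation it can be read in either direction by passing to the converse.\<close>

definition rel_poly :: "('c::field \<times> 'c) set \<Rightarrow> 'c poly \<Rightarrow> 'c poly \<Rightarrow> bool" where
  "rel_poly R p p' \<longleftrightarrow> (\<forall>i. (Polynomial.coeff p i, Polynomial.coeff p' i) \<in> R)"

lemma rel_poly_converse: "rel_poly (R\<inverse>) p p' \<longleftrightarrow> rel_poly R p' p"
  by (simp add: rel_poly_def)

section \<open>Division and minimal polynomials along a maximal partial isomorphism\<close>

locale max_iso = sub_field L for L :: "'c::field set" +
  fixes R :: "('c \<times> 'c) set"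
  assumes max: "max_partial_iso L R"
begin

lemma iso: "partial_iso L R"
  using max by (simp add: max_partial_iso_def)

lemma maximal: "partial_iso L R' \<Longrightarrow> R \<subseteq> R' \<Longrightarrow> p \<in> R' \<Longrightarrow> p \<in> R"
  using max by (auto simp: max_partial_iso_def)

lemma R_one: "(1, 1) \<in> R"
  and R_add: "(x, y) \<in> R \<Longrightarrow> (z, w) \<in> R \<Longrightarrow> (x + z, y + w) \<in> R"
  and R_mult: "(x, y) \<in> R \<Longrightarrow> (z, w) \<in> R \<Longrightarrow> (x * z, y * w) \<in> R"
  and R_uminus: "(x, y) \<in> R \<Longrightarrow> (- x, - y) \<in> R"
  and R_zero_iff: "(x, y) \<in> R \<Longrightarrow> x = 0 \<longleftrightarrow> y = 0"
  and R_subset: "(x, y) \<in> R \<Longrightarrow> x \<in> L \<and> y \<in> L"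
  using iso unfolding partial_iso_def by blast+

lemma R_zero: "(0, 0) \<in> R"
  using R_add[OF R_one R_uminus[OF R_one]] by simp

lemma R_diff: "(x, y) \<in> R \<Longrightarrow> (z, w) \<in> R \<Longrightarrow> (x - z, y - w) \<in> R"
  using R_add[OF _ R_uminus, of x y z w] by simp

lemma R_divide:
  assumes "(x, y) \<in> R" "(z, w) \<in> R" "z \<noteq> 0"
  shows "(x / z, y / w) \<in> R"
proof (rule maximal)
  let ?R' = "{(x / z, y / w) |x y z w. (x, y) \<in> R \<and> (z, w) \<in> R \<and> z \<noteq> 0}"
  show "partial_iso L ?R'"
    by (rule partial_iso_localization[OF iso]) unfold_locales
  show "R \<subseteq> ?R'"
  proof
    fix p assume "p \<in> R"
    then show "p \<in> ?R'"
      using R_one by (intro CollectI exI[of _ "fst p"] exI[of _ "snd p"] exI[of _ 1]) simp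
  qed
  show "(x / z, y / w) \<in> ?R'"
    using assms by blast
qed

lemma R_sum: "(\<And>i. i \<in> I \<Longrightarrow> (f i, g i) \<in> R) \<Longrightarrow> (sum f I, sum g I) \<in> R"
  by (induction I rule: infinite_finite_induct) (auto simp: R_add R_zero)

lemma rel_poly_add: "rel_poly R p p' \<Longrightarrow> rel_poly R r r' \<Longrightarrow> rel_poly R (p + r) (p' + r')"
  by (simp add: rel_poly_def R_add)

lemma rel_poly_diff: "rel_poly R p p' \<Longrightarrow> rel_poly R r r' \<Longrightarrow> rel_poly R (p - r) (p' - r')"
  by (simp add: rel_poly_def R_diff)

lemma rel_poly_mult: "rel_poly R p p' \<Longrightarrow> rel_poly R r r' \<Longrightarrow> rel_poly R (p * r) (p' * r')"
  by (simp add: rel_poly_def coeff_mult R_sum R_mult)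

lemma rel_poly_monom: "(x, y) \<in> R \<Longrightarrow> rel_poly R (monom x n) (monom y n)"
  by (simp add: rel_poly_def R_zero)

lemma rel_poly_degree:
  assumes "rel_poly R p p'"
  shows "degree p' = degree p"
proof -
  have "Polynomial.coeff p i = 0 \<longleftrightarrow> Polynomial.coeff p' i = 0" for i
    using assms R_zero_iff by (auto simp: rel_poly_def)
  then show ?thesis
    by (simp add: degree_def)
qed

lemma rel_poly_zero_iff:
  assumes "rel_poly R p p'"
  shows "p = 0 \<longleftrightarrow> p' = 0"
  using assms R_zero_iff by (auto simp: rel_poly_def poly_eq_iff)

text \<open>Long division is carried out on both polynomials at once: the quotients of leading
  coefficients stay related because \<open>R\<close> is closed under division.\<close>

lemma rel_poly_division:
  assumes "rel_poly R f f'" "f \<noteq> 0" "rel_poly R g g'"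
  obtains a a' r r' where "rel_poly R a a'" "rel_poly R r r'"
    "g = a * f + r" "g' = a' * f' + r'" "r = 0 \<or> degree r < degree f"
proof -
  have "\<exists>a a' r r'. rel_poly R a a' \<and> rel_poly R r r' \<and> g = a * f + r \<and> g' = a' * f' + r' \<and>
      (r = 0 \<or> degree r < degree f)"
    using assms(3)
  proof (induction "degree g" arbitrary: g g' rule: less_induct)
    case less
    show ?case
    proof (cases "g = 0 \<or> degree g < degree f")
      case True
      then show ?thesis
        using less.prems R_zero by (intro exI[of _ 0] exI[of _ g] exI[of _ g']) (auto simp: rel_poly_def)
    next
      case False
      define m where "m = monom (lead_coeff g / lead_coeff f) (degree g - degree f)"
      define m' where "m' = monom (lead_coeff g' / lead_coeff f') (degree g' - degree f')"
      have deg: "degree g' = degree g" "degree f' = degree f"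
        using less.prems assms(1) rel_poly_degree by auto
      have m: "rel_poly R m m'"
        unfolding m_def m'_def deg using less.prems assms
        by (intro rel_poly_monom R_divide) (auto simp: rel_poly_def)
      let ?h = "g - m * f" and ?h' = "g' - m' * f'"
      have h: "rel_poly R ?h ?h'"
        using less.prems assms(1) m by (intro rel_poly_diff rel_poly_mult)
      have "\<exists>a a' r r'. rel_poly R a a' \<and> rel_poly R r r' \<and> ?h = a * f + r \<and> ?h' = a' * f' + r' \<and>
          (r = 0 \<or> degree r < degree f)"
      proof (cases "?h = 0")
        case True
        then show ?thesis
          using R_zero rel_poly_zero_iff[OF h]
          by (intro exI[of _ 0]) (auto simp: rel_poly_def)
      next
        case False': False
        have m0: "m \<noteq> 0" "degree m = degree g - degree f"
          using False assms(2) by (auto simp: m_def degree_monom_eq)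
        then have "degree (m * f) = degree g"
          using False assms(2) by (simp add: degree_mult_eq)
        moreover have "lead_coeff m = lead_coeff g / lead_coeff f"
          using m0(2) by (simp add: m_def)
        then have "lead_coeff (m * f) = lead_coeff g"
          using assms(2) by (simp add: lead_coeff_mult)
        ultimately have "degree ?h \<le> degree g" "Polynomial.coeff ?h (degree g) = 0"
          by (simp_all add: degree_diff_le)
        then have "degree ?h < degree g"
          using False' leading_coeff_0_iff le_neq_implies_less by metis
        then show ?thesis
          by (rule less.hyps) (rule h)
      qed
      then obtain a a' r r' where "rel_poly R a a'" "rel_poly R r r'" "?h = a * f + r"
        "?h' = a' * f' + r'" "r = 0 \<or> degree r < degree f"
        by blast
      then show ?thesis
        using m by (intro exI[of _ "a + m"] exI[of _ "a' + m'"] exI[of _ r] exI[of _ r'])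
           (auto simp: algebra_simps rel_poly_add)
    qed
  qed
  then show ?thesis
    using that by blast
qed

text \<open>Here \<open>f\<close> is a minimal polynomial of \<open>x\<close> over the domain of
  \<open>R\<close>. The remainder of \<open>g\<close> vanishes at \<open>x\<close>, hence is zero by
  minimality, and its partner is zero with it.\<close>

lemma minimal_poly_dvd:
  assumes f: "rel_poly R f f'" "f \<noteq> 0" "poly f x = 0"
    and min: "\<forall>g g'. rel_poly R g g' \<longrightarrow> g \<noteq> 0 \<longrightarrow> poly g x = 0 \<longrightarrow> degree f \<le> degree g"
    and g: "rel_poly R g g'" "poly g x = 0"
  obtains a a' where "rel_poly R a a'" "g = a * f" "g' = a' * f'"
proof -
  obtain a a' r r' where d: "rel_poly R a a'" "rel_poly R r r'" "g = a * f + r" "g' = a' * f' + r'"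
    "r = 0 \<or> degree r < degree f"
    using rel_poly_division[OF f(1,2) g(1)] .
  have "poly r x = 0"
    using d(3) f(3) g(2) by simp
  then have "r = 0"
    using min d(2,5) by (metis not_le)
  moreover from this have "r' = 0"
    using rel_poly_zero_iff[OF d(2)] by simp
  ultimately show ?thesis
    using d that by simp
qed

lemma max_iso_converse: "max_iso L (R\<inverse>)"
  by unfold_locales (rule max_partial_iso_converse[OF max])

end

text \<open>The element \<open>x\<close> is adjoined to the domain: its minimal polynomial f
  corresponds to a divisor f' of the separable polynomial \<open>h\<close>, f' has a root y in
  \<open>L\<close>, and g(x) -> g'(y) extends \<open>R\<close>. By maximality \<open>R\<close>
  already contains (x, y).\<close>

lemma max_iso_domain:
  assumes "max_iso L R" "x \<in> L"
    and closed: "\<And>f. separable_poly_over L f \<Longrightarrow> degree f > 0 \<Longrightarrow> \<exists>y\<in>L. poly f y = 0"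
    and h: "\<And>i. (Polynomial.coeff h i, Polynomial.coeff h i) \<in> R" "coprime h (pderiv h)" "poly h x = 0"
  shows "\<exists>y. (x, y) \<in> R"
proof -
  interpret max_iso L R by fact
  interpret conv: max_iso L "R\<inverse>" by (rule max_iso_converse)
  have hh: "rel_poly R h h" "h \<noteq> 0"
    using h by (auto simp: rel_poly_def)
  let ?P = "\<lambda>d. \<exists>f f'. rel_poly R f f' \<and> f \<noteq> 0 \<and> poly f x = 0 \<and> degree f = d"
  have "?P (degree h)"
    using hh h(3) by blast
  then have "?P (LEAST d. ?P d)"
    by (rule LeastI)
  then obtain f f' where f: "rel_poly R f f'" "f \<noteq> 0" "poly f x = 0" "degree f = (LEAST d. ?P d)"
    by blast
  have f_min: "\<forall>g g'. rel_poly R g g' \<longrightarrow> g \<noteq> 0 \<longrightarrow> poly g x = 0 \<longrightarrow> degree f \<le> degree g"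
    unfolding f(4) by (intro allI impI Least_le) blast
  have deg_f': "degree f' = degree f" and f'0: "f' \<noteq> 0"
    using rel_poly_degree[OF f(1)] rel_poly_zero_iff[OF f(1)] f(2) by auto
  have f'_L: "\<forall>i. Polynomial.coeff f' i \<in> L"
    using f(1) R_subset by (auto simp: rel_poly_def)
  \<comment> \<open>The polynomial \<open>h\<close> is related to itself, so divisibility by
    \<open>f\<close> turns into divisibility by \<open>f'\<close>.\<close>
  obtain a a' where h_eq: "h = a' * f'"
    by (rule minimal_poly_dvd[OF f(1-3) f_min hh(1) h(3)])
  have "coprime f' (pderiv f')"
  proof (rule coprimeI)
    fix c assume c: "c dvd f'" "c dvd pderiv f'"
    then have "c dvd h" "c dvd pderiv h"
      by (auto simp: h_eq pderiv_mult)
    with h(2) show "is_unit c"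
      by (rule coprime_common_divisor)
  qed
  moreover have "degree f' > 0"
  proof (rule ccontr)
    assume "\<not> degree f' > 0"
    then have "degree f = 0"
      using deg_f' by simp
    then show False
      using f(2,3) by (auto elim!: degree_eq_zeroE)
  qed
  ultimately obtain y where y: "y \<in> L" "poly f' y = 0"
    using closed[of f'] f'_L by (auto simp: separable_poly_over_def)
  \<comment> \<open>The polynomial \<open>m'\<close> chosen below is a minimal polynomial of
    \<open>y\<close> over the range of \<open>R\<close>. Comparing it with \<open>f'\<close> lets
    zeros be transferred from \<open>y\<close> back to \<open>x\<close>.\<close>
  let ?Q = "\<lambda>d. \<exists>g g'. rel_poly R g g' \<and> g' \<noteq> 0 \<and> poly g' y = 0 \<and> degree g' = d"
  have "?Q (degree f')"
    using f y f'0 by blast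
  then have "?Q (LEAST d. ?Q d)"
    by (rule LeastI)
  then obtain m m' where m: "rel_poly R m m'" "m' \<noteq> 0" "poly m' y = 0" "degree m' = (LEAST d. ?Q d)"
    by blast
  have m_min: "\<forall>g' g. rel_poly (R\<inverse>) g' g \<longrightarrow> g' \<noteq> 0 \<longrightarrow> poly g' y = 0 \<longrightarrow> degree m' \<le> degree g'"
    unfolding m(4) rel_poly_converse by (intro allI impI Least_le) blast
  have m_conv: "rel_poly (R\<inverse>) m' m"
    using m(1) by (simp add: rel_poly_converse)
  obtain b b' where b: "rel_poly R b b'" "f = b * m" "f' = b' * m'"
    using conv.minimal_poly_dvd[OF m_conv m(2,3) m_min, of f' f] f(1) y(2)
    unfolding rel_poly_converse by blast
  \<comment> \<open>Otherwise the cofactor \<open>b\<close> would vanish at \<open>x\<close>;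
    minimality of \<open>f\<close>, which is \<open>b * m\<close>, then makes \<open>m\<close>
    constant and with it \<open>m'\<close>, although \<open>m'\<close> has the root
    \<open>y\<close>.\<close>
  have "poly m x = 0"
  proof (rule ccontr)
    assume "poly m x \<noteq> 0"
    then have "poly b x = 0" "b \<noteq> 0" "m \<noteq> 0"
      using f(2,3) b(2) by auto
    then have "degree m = 0"
      using f_min[rule_format, OF b(1)] b(2) by (simp add: degree_mult_eq)
    then have "degree m' = 0"
      using rel_poly_degree[OF m(1)] by simp
    then show False
      using m(2,3) by (auto elim!: degree_eq_zeroE)
  qed
  have transfer: "poly g x = 0 \<longleftrightarrow> poly g' y = 0" if g: "rel_poly R g g'" for g g'
  proof
    assume "poly g x = 0"
    then obtain c c' where "g' = c' * f'"
      by (rule minimal_poly_dvd[OF f(1-3) f_min g])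
    then show "poly g' y = 0"
      using y by simp
  next
    assume "poly g' y = 0"
    then obtain c c' where "g = c' * m"
      using conv.minimal_poly_dvd[OF m_conv m(2,3) m_min, of g' g] g by (auto simp: rel_poly_converse)
    then show "poly g x = 0"
      using \<open>poly m x = 0\<close> by simp
  qed
  \<comment> \<open>The ring generated by \<open>x\<close> over the domain is paired with the ring
    generated by \<open>y\<close> over the range; \<open>transfer\<close> supplies the zero
    condition.\<close>
  let ?R' = "{(poly g x, poly g' y) |g g'. rel_poly R g g'}"
  have "partial_iso L ?R'"
    unfolding partial_iso_def
  proof (intro conjI allI impI)
    show "?R' \<subseteq> L \<times> L"
      using R_subset \<open>x \<in> L\<close> y(1) by (auto simp: rel_poly_def intro!: poly_mem)
    have "rel_poly R 1 1"
      using rel_poly_monom[OF R_one, of 0] by (simp add: monom_0 one_pCons)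
    then show "(1, 1) \<in> ?R'"
      by (intro CollectI exI[of _ 1]) auto
    fix u w assume "(u, w) \<in> ?R'"
    then obtain g g' where uw: "u = poly g x" "w = poly g' y" "rel_poly R g g'"
      by blast
    have "rel_poly R (- g) (- g')"
      using uw(3) by (simp add: rel_poly_def R_uminus)
    then show "(- u, - w) \<in> ?R'"
      unfolding uw by (intro CollectI exI[of _ "- g"] exI[of _ "- g'"]) auto
    show "u = 0 \<longleftrightarrow> w = 0"
      unfolding uw by (rule transfer) fact
    fix u' w' assume "(u', w') \<in> ?R'"
    then obtain k k' where uw': "u' = poly k x" "w' = poly k' y" "rel_poly R k k'"
      by blast
    show "(u + u', w + w') \<in> ?R'"
      unfolding uw uw' using rel_poly_add[OF uw(3) uw'(3)]
      by (intro CollectI exI[of _ "g + k"] exI[of _ "g' + k'"]) auto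
    show "(u * u', w * w') \<in> ?R'"
      unfolding uw uw' using rel_poly_mult[OF uw(3) uw'(3)]
      by (intro CollectI exI[of _ "g * k"] exI[of _ "g' * k'"]) auto
  qed
  moreover have "R \<subseteq> ?R'"
  proof
    fix p assume "p \<in> R"
    then have "rel_poly R [:fst p:] [:snd p:]"
      using rel_poly_monom[of "fst p" "snd p" 0] by (simp add: monom_0)
    then show "p \<in> ?R'"
      by (intro CollectI exI[of _ "[:fst p:]"] exI[of _ "[:snd p:]"]) auto
  qed
  moreover have "(x, y) \<in> ?R'"
    using rel_poly_monom[OF R_one, of 1]
    by (intro CollectI exI[of _ "monom 1 1"]) (auto simp: poly_monom)
  ultimately have "(x, y) \<in> R"
    by (rule maximal)
  then show ?thesis ..
qed

text \<open>A maximal extension of \<open>R\<^sub>0\<close> has domain \<open>L\<close> by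
  separability, and range \<open>L\<close> by the same argument for its converse, so it is the graph
  of an automorphism. It contains the diagonal of \<open>K\<close> because it is closed under
  quotients.\<close>

theorem partial_iso_extends_to_Gal:
  fixes L :: "'c::field set"
  assumes sep: "separable_closure K L" and R\<^sub>0: "partial_iso L R\<^sub>0"
    and K: "\<And>c. c \<in> K \<Longrightarrow> \<exists>x y. (x, x) \<in> R\<^sub>0 \<and> (y, y) \<in> R\<^sub>0 \<and> y \<noteq> 0 \<and> c = x / y"
  obtains \<gamma> where "\<gamma> \<in> carrier (Gal L K)" "\<And>x y. (x, y) \<in> R\<^sub>0 \<Longrightarrow> \<gamma> x = y"
proof -
  obtain R where R: "max_partial_iso L R" "R\<^sub>0 \<subseteq> R"
    using max_partial_iso_exists[OF R\<^sub>0] .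
  interpret sub_field L
    by (rule sub_field_subfield) (use sep in \<open>simp add: separable_closure_def\<close>)
  interpret max_iso L R
    by unfold_locales (rule R)
  have diag: "(c, c) \<in> R" if "c \<in> K" for c
    using K[OF that] R(2) by (auto intro!: R_divide)
  have closed: "\<exists>y\<in>L. poly f y = 0" if "separable_poly_over L f" "degree f > 0" for f
    using sep that by (simp add: separable_closure_def)
  have sep_over: "\<exists>h. (\<forall>i. Polynomial.coeff h i \<in> K) \<and> coprime h (pderiv h) \<and> poly h x = 0"
    if "x \<in> L" for x
    using sep that unfolding separable_closure_def separable_poly_over_def by blast
  have dom: "\<exists>y. (x, y) \<in> R" if "x \<in> L" for x
    using sep_over[OF that] max_iso_domain[OF max_iso_axioms that closed] diag by blast
  have ran: "\<exists>y. (y, x) \<in> R" if "x \<in> L" for x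
    using sep_over[OF that] max_iso_domain[OF max_iso_converse that closed] diag
    by (metis converse_iff)
  \<comment> \<open>The zero condition applied to a difference of two pairs gives single-valuedness
    here and injectivity next.\<close>
  have unique: "y = y'" if "(x, y) \<in> R" "(x, y') \<in> R" for x y y'
    using R_diff[OF that] R_zero_iff[of "x - x" "y - y'"] by simp
  have inj: "x = x'" if "(x, y) \<in> R" "(x', y) \<in> R" for x x' y
    using R_diff[OF that] R_zero_iff[of "x - x'" "y - y"] by simp
  define \<gamma> where "\<gamma> = (\<lambda>x\<in>L. THE y. (x, y) \<in> R)"
  have \<gamma>: "\<gamma> x = y" if "(x, y) \<in> R" for x y
    using that R_subset[OF that] unique by (auto simp: \<gamma>_def)
  have \<gamma>_mem: "(x, \<gamma> x) \<in> R" if "x \<in> L" for x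
    using dom[OF that] \<gamma> by auto
  have "bij_betw \<gamma> L L"
    unfolding bij_betw_def
  proof
    show "inj_on \<gamma> L"
      using \<gamma>_mem inj by (metis inj_onI)
    show "\<gamma> ` L = L"
    proof
      show "\<gamma> ` L \<subseteq> L"
        using \<gamma>_mem R_subset by blast
      show "L \<subseteq> \<gamma> ` L"
      proof
        fix y assume "y \<in> L"
        then obtain x where "(x, y) \<in> R"
          using ran by blast
        then show "y \<in> \<gamma> ` L"
          using \<gamma> R_subset by (metis imageI)
      qed
    qed
  qed
  then have "\<gamma> \<in> Bij L"
    by (simp add: Bij_def \<gamma>_def)
  moreover have "\<gamma> (x + y) = \<gamma> x + \<gamma> y" "\<gamma> (x * y) = \<gamma> x * \<gamma> y" if "x \<in> L" "y \<in> L" for x y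
    using that by (auto intro!: \<gamma> R_add R_mult \<gamma>_mem)
  ultimately have "\<gamma> \<in> carrier (Gal L K)"
    using \<gamma>[OF diag] by (simp add: Gal_def)
  then show ?thesis
    using that \<gamma> R(2) by blast
qed

section \<open>The field of constants and the Anderson--Thakur function\<close>

locale C_infinity =
  fixes j :: "'f::{finite,field} fls alg_closure \<Rightarrow> 'c::field"
    and v :: "'c \<Rightarrow> real"
  assumes C_infinity: "is_C_infinity j v"
begin

abbreviation "\<theta> \<equiv> theta j"

sublocale j: field_hom j
  using C_infinity by (simp add: is_C_infinity_def)

sublocale Fq: field_hom "Fq j"
  by unfold_locales (simp_all add: Fq_def j.hom_add j.hom_mult flip: fls_plus_const fls_const_mult_const)

sublocale Fq_poly: map_poly_inj_idom_hom "Fq j" ..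

lemma q_ge_2: "CARD('f) \<ge> 2"
  by (rule card_field_ge_2)

lemma power_q_eq: "x ^ CARD('f) = x * x ^ (CARD('f) - 1)"
  using q_ge_2 by (cases "CARD('f)") auto

lemma theta_nonzero [simp]: "\<theta> \<noteq> 0"
  by (simp add: theta_def)

lemma v_nonneg [simp]: "v x \<ge> 0"
  and v_eq_0_iff [simp]: "v x = 0 \<longleftrightarrow> x = 0"
  and v_mult: "v (x * y) = v x * v y"
  and v_add: "v (x + y) \<le> max (v x) (v y)"
  using C_infinity by (auto simp: is_C_infinity_def nonarch_absolute_value_def)

lemma v_zero [simp]: "v 0 = 0"
  by simp

lemma v_one [simp]: "v 1 = 1"
  using v_mult[of 1 1] by simp

lemma v_power: "v (x ^ n) = v x ^ n"
  by (induction n) (simp_all add: v_mult)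

lemma v_uminus [simp]: "v (- x) = v x"
proof -
  have "v (- 1) ^ 2 = 1"
    unfolding v_power[symmetric] by simp
  then have "v (- 1) = 1"
    using v_nonneg[of "- 1"] by (simp add: power2_eq_1_iff)
  then show ?thesis
    using v_mult[of "- 1" x] by simp
qed

lemma v_diff: "v (x - y) \<le> max (v x) (v y)"
  using v_add[of x "- y"] by simp

lemma v_minus_commute: "v (x - y) = v (y - x)"
  using v_uminus[of "x - y"] by simp

lemma v_inverse: "v (inverse x) = inverse (v x)"
proof (cases "x = 0")
  case False
  then have "v x * v (inverse x) = 1"
    by (simp flip: v_mult)
  then show ?thesis
    by (rule inverse_unique[symmetric])
qed simp

lemma v_divide: "v (x / y) = v x / v y"
  by (simp add: divide_inverse v_mult v_inverse)

lemma v_theta: "v \<theta> = CARD('f)"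
proof -
  have "v (j (to_ac (fls_X_inv :: 'f fls))) = real CARD('f) powi (- fls_subdegree (fls_X_inv :: 'f fls))"
    using C_infinity by (simp add: is_C_infinity_def)
  then show ?thesis
    by (simp add: theta_def)
qed

lemma poly_theta: "poly (map_poly (Fq j) p) \<theta> = j (to_ac (poly (map_poly fls_const p) fls_X_inv))"
  by (induction p) (simp_all add: hom_distribs Fq_def theta_def j.hom_add j.hom_mult)

text \<open>In the Laurent series field, the value of \<open>p\<close> at theta has the leading
  coefficient of \<open>p\<close> in exponent -deg p.\<close>

lemma theta_transcendental: "poly (map_poly (Fq j) p) \<theta> = 0 \<longleftrightarrow> p = 0"
proof
  assume "poly (map_poly (Fq j) p) \<theta> = 0"
  then have 0: "poly (map_poly fls_const p) fls_X_inv = 0"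
    by (simp add: poly_theta)
  have "poly (map_poly fls_const p) fls_X_inv =
      (\<Sum>i\<le>degree p. fls_const (Polynomial.coeff p i) * fls_X_inv ^ i)"
    by (simp add: poly_altdef coeff_map_poly degree_map_poly)
  then have *: "(\<Sum>i\<le>degree p. fls_const (Polynomial.coeff p i) * fls_X_inv ^ i) = 0"
    using 0 by simp
  have "lead_coeff p = fls_nth (\<Sum>i\<le>degree p. fls_const (Polynomial.coeff p i) * fls_X_inv ^ i)
      (- int (degree p))"
    by (simp add: fls_nth_sum if_distrib cong: if_cong)
  then show "p = 0"
    unfolding * by simp
qed simp

lemma frobenius_add: "(x + y) ^ CARD('f) = x ^ CARD('f) + y ^ CARD('f)" for x y :: 'c
proof -
  have "of_nat (CARD('f) choose i) = (0::'c)" if "0 < i" "i < CARD('f)" for i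
    using of_nat_choose_card_field[OF that] by (metis Fq.hom_of_nat Fq.hom_zero)
  then have "(\<Sum>i\<in>{0<..<CARD('f)}. of_nat (CARD('f) choose i) * x ^ i * y ^ (CARD('f) - i)) = 0"
    by (intro sum.neutral) auto
  moreover have "{..CARD('f)} = insert 0 (insert CARD('f) {0<..<CARD('f)})"
    by auto
  ultimately show ?thesis
    using q_ge_2 by (simp add: binomial_ring)
qed

sublocale frob: ring_hom_on UNIV "\<lambda>x::'c. x ^ CARD('f)"
  using q_ge_2 by unfold_locales (auto simp: frobenius_add power_mult_distrib)

lemma fps_over_UNIV [simp]: "f \<in> frob.fps_over"
  by (simp add: frob.fps_over_def)

lemma Fq_power: "Fq j a ^ CARD('f) = Fq j a"
  by (simp add: finite_field_power_card flip: Fq.hom_power)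

text \<open>The polynomial X^q - X has at most q roots, and the q elements of the image of F_q are
  roots.\<close>

lemma frob_fixed_iff: "x ^ CARD('f) = x \<longleftrightarrow> x \<in> range (Fq j)"
proof -
  let ?p = "monom 1 CARD('f) - monom 1 1 :: 'c poly"
  have "Polynomial.coeff ?p CARD('f) = 1"
    using q_ge_2 by simp
  then have p: "?p \<noteq> 0"
    by (metis coeff_0 zero_neq_one)
  have deg: "degree ?p \<le> CARD('f)"
    using q_ge_2 by (intro degree_diff_le) (auto intro: order_trans[OF degree_monom_le])
  have roots: "{x. poly ?p x = 0} = {x. x ^ CARD('f) = x}"
    by (auto simp: poly_monom)
  have "card {x::'c. x ^ CARD('f) = x} \<le> CARD('f)"
    using card_poly_roots_bound[OF p] deg unfolding roots by simp
  moreover have "card (range (Fq j)) = CARD('f)"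
    by (simp add: card_image Fq.inj_f)
  moreover have "range (Fq j) \<subseteq> {x. x ^ CARD('f) = x}"
    by (auto simp: Fq_power)
  moreover have "finite {x::'c. x ^ CARD('f) = x}"
    using poly_roots_finite[OF p] unfolding roots .
  ultimately have "range (Fq j) = {x. x ^ CARD('f) = x}"
    by (intro card_seteq) auto
  then show ?thesis
    by auto
qed

section \<open>Limits for the absolute value \<open>v\<close>\<close>

lemma Metric_space_abs_dist: "Metric_space UNIV (abs_dist v)"
proof
  show "abs_dist v x z \<le> abs_dist v x y + abs_dist v y z" for x y z
  proof -
    have "v (x - z) \<le> max (v (x - y)) (v (y - z))"
      using v_add[of "x - y" "y - z"] by simp
    also have "\<dots> \<le> v (x - y) + v (y - z)"
      by simp
    finally show ?thesis
      by (simp add: abs_dist_def)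
  qed
qed (auto simp: abs_dist_def v_minus_commute)

sublocale M: Metric_space UNIV "abs_dist v"
  by (rule Metric_space_abs_dist)

definition converges_to :: "(nat \<Rightarrow> 'c) \<Rightarrow> 'c \<Rightarrow> bool" where
  "converges_to x l \<longleftrightarrow> (\<lambda>m. v (x m - l)) \<longlonglongrightarrow> 0"

lemma limitin_iff: "limitin M.mtopology x l sequentially \<longleftrightarrow> converges_to x l"
  by (simp add: M.limitin_metric_dist_null converges_to_def abs_dist_def)

lemma converges_to_unique: "converges_to x l \<Longrightarrow> converges_to x l' \<Longrightarrow> l = l'"
  using M.limitin_metric_unique[of x l sequentially l'] by (simp add: limitin_iff)

lemma converges_to_diff:
  assumes "converges_to x l" "converges_to y m"
  shows "converges_to (\<lambda>n. x n - y n) (l - m)"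
  unfolding converges_to_def
proof (rule Lim_null_comparison)
  show "\<forall>\<^sub>F n in sequentially. norm (v (x n - y n - (l - m))) \<le> v (x n - l) + v (y n - m)"
  proof (intro always_eventually allI)
    fix n
    have "x n - y n - (l - m) = (x n - l) - (y n - m)"
      by simp
    then have "v (x n - y n - (l - m)) \<le> max (v (x n - l)) (v (y n - m))"
      using v_diff by metis
    also have "\<dots> \<le> v (x n - l) + v (y n - m)"
      by simp
    finally show "norm (v (x n - y n - (l - m))) \<le> v (x n - l) + v (y n - m)"
      by simp
  qed
  show "(\<lambda>n. v (x n - l) + v (y n - m)) \<longlonglongrightarrow> 0"
    using tendsto_add[OF assms[unfolded converges_to_def]] by simp
qed

lemma converges_to_cmult:
  assumes "converges_to x l"
  shows "converges_to (\<lambda>n. c * x n) (c * l)"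
proof -
  have "(\<lambda>n. v c * v (x n - l)) \<longlonglongrightarrow> v c * 0"
    using assms unfolding converges_to_def by (intro tendsto_intros)
  then show ?thesis
    by (simp add: converges_to_def right_diff_distrib flip: v_mult)
qed

lemma converges_to_frob:
  assumes "converges_to x l"
  shows "converges_to (\<lambda>n. x n ^ CARD('f)) (l ^ CARD('f))"
proof -
  have "(\<lambda>n. v (x n - l) ^ CARD('f)) \<longlonglongrightarrow> 0 ^ CARD('f)"
    using assms unfolding converges_to_def by (intro tendsto_intros)
  moreover have "x n ^ CARD('f) - l ^ CARD('f) = (x n - l) ^ CARD('f)" for n
    using frobenius_add[of "x n - l" l] by simp
  ultimately show ?thesis
    using q_ge_2 by (simp add: converges_to_def v_power power_0_left)
qed

text \<open>By the ultrametric inequality x_(m+k) - x_m is bounded by the largest step in between,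
  hence by r^m; completeness then gives the limit.\<close>

lemma nonarch_Cauchy:
  assumes "\<And>m. v (x (Suc m) - x m) \<le> r ^ m" "0 \<le> r" "r < 1"
  shows "\<exists>l. converges_to x l"
proof -
  have le: "v (x (m + k) - x m) \<le> r ^ m" for m k
  proof (induction k)
    case (Suc k)
    have "v (x (m + Suc k) - x m) \<le> max (v (x (Suc (m + k)) - x (m + k))) (v (x (m + k) - x m))"
      using v_add[of "x (Suc (m + k)) - x (m + k)" "x (m + k) - x m"] by simp
    moreover have "r ^ (m + k) \<le> r ^ m"
      using assms(2,3) by (intro power_decreasing) auto
    ultimately show ?case
      using assms(1)[of "m + k"] Suc.IH by simp
  qed (use assms(2) in simp)
  have "M.MCauchy x"
    unfolding M.MCauchy_def
  proof (intro conjI allI impI)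
    fix e :: real assume "e > 0"
    then obtain N where N: "r ^ N < e"
      using assms(3) real_arch_pow_inv by blast
    show "\<exists>N. \<forall>n n'. N \<le> n \<longrightarrow> N \<le> n' \<longrightarrow> abs_dist v (x n) (x n') < e"
    proof (intro exI allI impI)
      fix n n' assume "N \<le> n" "N \<le> n'"
      then have "v (x n - x N) < e" "v (x n' - x N) < e"
        using le[of N "n - N"] le[of N "n' - N"] N by simp_all
      then show "abs_dist v (x n) (x n') < e"
        using v_diff[of "x n - x N" "x n' - x N"] by (simp add: abs_dist_def)
    qed
  qed simp
  moreover have "M.mcomplete"
    using C_infinity by (simp add: is_C_infinity_def)
  ultimately show ?thesis
    by (auto simp: M.mcomplete_def limitin_iff)
qed

section \<open>The partial products of omega and their coefficientwise limit\<close>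

definition omega_prod :: "nat \<Rightarrow> 'c fps" where
  "omega_prod m = (\<Prod>i<m. inverse (1 - fps_const (1 / \<theta> ^ (CARD('f) ^ i)) * fps_X))"

lemma omega_prod_Suc:
  "omega_prod (Suc m) * (1 - fps_const (1 / \<theta> ^ (CARD('f) ^ m)) * fps_X) = omega_prod m"
proof -
  have "inverse (1 - fps_const c * fps_X) * (1 - fps_const c * fps_X) = 1" for c :: 'c
    by (rule inverse_mult_eq_1) simp
  then show ?thesis
    by (simp add: omega_prod_def mult.assoc)
qed

lemma omega_prod_nth_0: "fps_nth (omega_prod m) 0 = 1"
  by (induction m) (simp_all add: omega_prod_def)

text \<open>This is coefficient n + 1 of \<open>omega_prod_Suc\<close>, rearranged. The increments
  carry the factor theta^(-q^m), which forces convergence.\<close>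

lemma omega_prod_nth_Suc:
  "fps_nth (omega_prod (Suc m)) (Suc n) - fps_nth (omega_prod m) (Suc n) =
     1 / \<theta> ^ (CARD('f) ^ m) * fps_nth (omega_prod (Suc m)) n"
  by (subst omega_prod_Suc[of m, symmetric])
     (simp add: right_diff_distrib mult.left_commute[of _ "fps_const _"])

text \<open>Replacing the exponent q^m by the smaller m gives a geometric bound of the form that
  \<open>nonarch_Cauchy\<close> asks for.\<close>

lemma v_theta_inverse_power: "v (1 / \<theta> ^ (CARD('f) ^ m)) \<le> (1 / CARD('f)) ^ m"
proof -
  have "m \<le> CARD('f) ^ m"
    using q_ge_2 less_exp[of m] power_mono[of 2 "CARD('f)" m] by linarith
  then have "(1 / real CARD('f)) ^ (CARD('f) ^ m) \<le> (1 / real CARD('f)) ^ m"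
    using q_ge_2 by (intro power_decreasing) auto
  then show ?thesis
    by (simp add: v_divide v_power v_theta power_one_over)
qed

lemma v_theta_inverse_power_le_1: "v (1 / \<theta> ^ (CARD('f) ^ m)) \<le> 1"
proof -
  have "(1 / real CARD('f)) ^ m \<le> 1"
    using q_ge_2 by (intro power_le_one) auto
  then show ?thesis
    using v_theta_inverse_power[of m] by linarith
qed

text \<open>Nested induction: a coefficient of the product with one more factor is the old
  coefficient plus a lower coefficient of the same new product, scaled by an element of absolute
  value at most 1.\<close>

lemma v_omega_prod: "v (fps_nth (omega_prod m) n) \<le> 1"
proof (induction m arbitrary: n)
  case 0
  then show ?case
    by (simp add: omega_prod_def)
next
  case (Suc m)
  show ?case
  proof (induction n)
    case 0
    then show ?case
      by (simp add: omega_prod_nth_0)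
  next
    case IH: (Suc n)
    have "v (1 / \<theta> ^ (CARD('f) ^ m) * fps_nth (omega_prod (Suc m)) n) \<le> 1"
      unfolding v_mult using v_theta_inverse_power_le_1 IH by (intro mult_le_one) auto
    then show ?case
      using omega_prod_nth_Suc[of m n] Suc.IH[of "Suc n"]
        v_add[of "fps_nth (omega_prod m) (Suc n)" "1 / \<theta> ^ (CARD('f) ^ m) * fps_nth (omega_prod (Suc m)) n"]
      by (simp add: algebra_simps)
  qed
qed

lemma omega_prod_converges: "\<exists>l. converges_to (\<lambda>m. fps_nth (omega_prod m) n) l"
proof (rule nonarch_Cauchy)
  fix m
  show "v (fps_nth (omega_prod (Suc m)) n - fps_nth (omega_prod m) n) \<le> (1 / CARD('f)) ^ m"
  proof (cases n)
    case 0
    then show ?thesis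
      by (simp add: omega_prod_nth_0)
  next
    case (Suc n')
    have "v (1 / \<theta> ^ (CARD('f) ^ m) * fps_nth (omega_prod (Suc m)) n') \<le> (1 / CARD('f)) ^ m * 1"
      unfolding v_mult using v_theta_inverse_power v_omega_prod by (intro mult_mono) auto
    then show ?thesis
      unfolding Suc omega_prod_nth_Suc by simp
  qed
qed (use q_ge_2 in auto)

text \<open>These are the coefficients of the infinite product without the factor
  \<open>lam\<close>, so the constant term is 1.\<close>

definition omega_lim :: "nat \<Rightarrow> 'c" where
  "omega_lim n = (THE l. converges_to (\<lambda>m. fps_nth (omega_prod m) n) l)"

lemma omega_lim: "converges_to (\<lambda>m. fps_nth (omega_prod m) n) (omega_lim n)"
  unfolding omega_lim_def
  by (rule theI') (use omega_prod_converges converges_to_unique in blast)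

text \<open>The twist raises theta^(-q^i) to the q-th power and so moves factor i to factor i + 1.
  The result is the next partial product with its factor for i = 0 removed.\<close>

lemma frob_omega_prod:
  "frob.fps_map (omega_prod m) = omega_prod (Suc m) * (1 - fps_const (1 / \<theta>) * fps_X)"
proof (induction m)
  case 0
  have "inverse (1 - fps_const (1 / \<theta>) * fps_X) * (1 - fps_const (1 / \<theta>) * fps_X) = 1"
    by (rule inverse_mult_eq_1) simp
  then show ?case
    using frob.ring_hom_on_fps[THEN ring_hom_on.one] by (simp add: omega_prod_def)
next
  case (Suc m)
  let ?f = "\<lambda>c. 1 - fps_const c * fps_X :: 'c fps"
  have f: "frob.fps_map (?f (1 / \<theta> ^ (CARD('f) ^ m))) = ?f (1 / \<theta> ^ (CARD('f) ^ Suc m))"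
    using q_ge_2
    by (auto simp: fps_eq_iff frob.uminus power_divide mult.commute[of "CARD('f)"] simp flip: power_mult)
  have "frob.fps_map (omega_prod (Suc m)) * ?f (1 / \<theta> ^ (CARD('f) ^ Suc m)) =
      frob.fps_map (omega_prod (Suc m) * ?f (1 / \<theta> ^ (CARD('f) ^ m)))"
    by (simp only: f frob.fps_map_mult fps_over_UNIV)
  also have "\<dots> = omega_prod (Suc (Suc m)) * ?f (1 / \<theta> ^ (CARD('f) ^ Suc m)) * ?f (1 / \<theta>)"
    unfolding omega_prod_Suc by (rule Suc.IH)
  also have "\<dots> = omega_prod (Suc (Suc m)) * ?f (1 / \<theta>) * ?f (1 / \<theta> ^ (CARD('f) ^ Suc m))"
    by (simp only: mult_ac)
  finally have "(frob.fps_map (omega_prod (Suc m)) - omega_prod (Suc (Suc m)) * ?f (1 / \<theta>)) *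
      ?f (1 / \<theta> ^ (CARD('f) ^ Suc m)) = 0"
    by (simp only: left_diff_distrib diff_self)
  moreover have "fps_nth (?f (1 / \<theta> ^ (CARD('f) ^ Suc m))) 0 \<noteq> 0"
    by simp
  then have "?f (1 / \<theta> ^ (CARD('f) ^ Suc m)) \<noteq> 0"
    by (metis fps_zero_nth)
  ultimately show ?case
    by simp
qed

lemma omega_lim_0: "omega_lim 0 = 1"
  using omega_lim[of 0] converges_to_unique[of "\<lambda>m. 1" _ 1]
  by (simp add: omega_prod_nth_0 converges_to_def)

text \<open>Both sides are limits of the same sequence, the q-th powers of coefficient n + 1 of the
  partial products; \<open>frob_omega_prod\<close> provides the right-hand side.\<close>

lemma omega_lim_Suc: "omega_lim (Suc n) ^ CARD('f) = omega_lim (Suc n) - omega_lim n / \<theta>"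
proof (rule converges_to_unique)
  show "converges_to (\<lambda>m. fps_nth (omega_prod m) (Suc n) ^ CARD('f)) (omega_lim (Suc n) ^ CARD('f))"
    by (intro converges_to_frob omega_lim)
  have shift: "converges_to (\<lambda>m. fps_nth (omega_prod (Suc m)) n) (omega_lim n)" for n
    using omega_lim[of n] unfolding converges_to_def by (rule LIMSEQ_Suc)
  have "fps_nth (omega_prod m) (Suc n) ^ CARD('f) =
      fps_nth (omega_prod (Suc m)) (Suc n) - 1 / \<theta> * fps_nth (omega_prod (Suc m)) n" for m
    using arg_cong[OF frob_omega_prod[of m], of "\<lambda>f. fps_nth f (Suc n)"]
    by (simp add: right_diff_distrib mult.left_commute[of _ "fps_const _"])
  then show "converges_to (\<lambda>m. fps_nth (omega_prod m) (Suc n) ^ CARD('f)) (omega_lim (Suc n) - omega_lim n / \<theta>)"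
    using converges_to_diff[OF shift[of "Suc n"] converges_to_cmult[OF shift[of n], of "1 / \<theta>"]]
    by simp
qed

lemma omega_nth: "fps_nth (omega j v lam) n = lam * omega_lim n"
  by (simp add: omega_def omega_lim_def limitin_iff omega_prod_def)

text \<open>The product contributes the factor 1 - t/theta, and lam^q = -theta lam turns it into t -
  theta.\<close>

theorem frob_omega:
  assumes "lam ^ (CARD('f) - 1) = - \<theta>"
  shows "frob.fps_map (omega j v lam) = (fps_X - fps_const \<theta>) * omega j v lam"
proof (rule fps_ext)
  fix n
  have lam: "lam ^ CARD('f) = - \<theta> * lam"
    using assms by (simp add: power_q_eq)
  show "fps_nth (frob.fps_map (omega j v lam)) n = fps_nth ((fps_X - fps_const \<theta>) * omega j v lam) n"
    by (cases n) (simp_all add: omega_nth power_mult_distrib lam omega_lim_0 omega_lim_Suc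
        left_diff_distrib right_diff_distrib)
qed

end

section \<open>The Tate module\<close>

locale carlitz = C_infinity j v
  for j :: "'f::{finite,field} fls alg_closure \<Rightarrow> 'c::field" and v +
  fixes L :: "'c set" and lam :: 'c
  assumes Ksep: "separable_closure (K_field j) L"
    and lam: "lam ^ (CARD('f) - 1) = - theta j"
begin

sublocale sub_field L
  by (rule sub_field_subfield) (use Ksep in \<open>simp add: separable_closure_def\<close>)

lemma K_field_I: "r \<noteq> 0 \<Longrightarrow>
    poly (map_poly (Fq j) p) \<theta> / poly (map_poly (Fq j) r) \<theta> \<in> K_field j"
  unfolding K_field_def by blast

lemma poly_theta_K: "poly (map_poly (Fq j) p) \<theta> \<in> K_field j"
  using K_field_I[of 1 p] by simp

lemma theta_K [simp]: "\<theta> \<in> K_field j"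
  using poly_theta_K[of "[:0, 1:]"] by simp

lemma Fq_K [simp]: "Fq j a \<in> K_field j"
  using poly_theta_K[of "[:a:]"] by (simp add: hom_distribs)

lemma K_field_subset: "K_field j \<subseteq> L"
  using Ksep by (simp add: separable_closure_def)

lemma theta_mem [simp]: "\<theta> \<in> L" and Fq_mem [simp]: "Fq j a \<in> L"
  using K_field_subset theta_K Fq_K by blast+

lemma separable_root:
  assumes "\<And>i. Polynomial.coeff f i \<in> L" "coprime f (pderiv f)" "degree f > 0"
  obtains x where "x \<in> L" "poly f x = 0"
  using Ksep assms unfolding separable_closure_def separable_poly_over_def by blast

lemma of_nat_q [simp]: "of_nat CARD('f) = (0::'c)"
  using of_nat_card_field_eq_0[where 'f='f] by (metis Fq.hom_of_nat Fq.hom_zero)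

lemma lam_power_q: "lam ^ CARD('f) = - \<theta> * lam"
  using lam by (simp add: power_q_eq)

lemma lam_nonzero [simp]: "lam \<noteq> 0"
  using lam q_ge_2 by (auto simp: power_0_left)

text \<open>The polynomial f = X^(q-1) + theta is separable because f + X f' = theta, as q - 1
  equals -1 in the field. Hence f has a root in \<open>L\<close>, and \<open>lam\<close> differs
  from it by a factor in F_q.\<close>

lemma lam_mem [simp]: "lam \<in> L"
proof -
  let ?f = "monom 1 (CARD('f) - 1) + [:\<theta>:]"
  have q: "CARD('f) - 1 > 0" "Suc (CARD('f) - 1 - 1) = CARD('f) - 1"
    using q_ge_2 by auto
  have "of_nat (CARD('f) - 1) = (- 1 :: 'c)"
    using q_ge_2 by (simp add: of_nat_diff)
  then have "pderiv ?f = monom (- 1) (CARD('f) - 1 - 1)"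
    by (simp add: pderiv_add pderiv_monom pderiv_pCons)
  then have bezout: "?f + [:0, 1:] * pderiv ?f = [:\<theta>:]"
    using q(2) by (simp add: monom_Suc[symmetric] add_monom)
  have dvd: "d dvd [:\<theta>:]" if "d dvd ?f" "d dvd pderiv ?f" for d
    using dvd_add[OF that(1) dvd_mult[OF that(2), of "[:0, 1:]"]] unfolding bezout .
  have unit: "is_unit [:\<theta>:]"
    by (simp add: is_unit_const_poly_iff dvd_field_iff)
  have "coprime ?f (pderiv ?f)"
    using dvd_unit_imp_unit[OF dvd unit] by (rule coprimeI)
  moreover have "degree ?f = CARD('f) - 1"
    using q(1) by (subst degree_add_eq_left) (auto simp: degree_monom_eq)
  moreover have "Polynomial.coeff ?f i \<in> L" for i
    by (auto simp: coeff_pCons split: nat.split intro: add_mem)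
  ultimately obtain x where x: "x \<in> L" "poly ?f x = 0"
    using q(1) separable_root[of ?f] by metis
  then have x': "x ^ (CARD('f) - 1) = - \<theta>"
    by (simp add: poly_monom eq_neg_iff_add_eq_0)
  then have "x \<noteq> 0"
    using q(1) by (auto simp: power_0_left)
  have "(lam / x) ^ (CARD('f) - 1) = 1"
    using lam x' by (simp add: power_divide)
  then have "(lam / x) ^ CARD('f) = lam / x"
    by (simp add: power_q_eq)
  then obtain a where "lam / x = Fq j a"
    by (auto simp: frob_fixed_iff)
  then have "lam = Fq j a * x"
    using \<open>x \<noteq> 0\<close> by (simp add: field_simps)
  then show ?thesis
    using x(1) by (simp add: mult_mem)
qed

text \<open>
  Two roots of \<open>X\<^sup>q + \<theta> X - c\<close> differ by an \<open>\<bbbF>\<^sub>q\<close>-multiple of \<open>lam\<close>.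
\<close>

lemma torsion_root_mem:
  assumes "x ^ CARD('f) + \<theta> * x \<in> L"
  shows "x \<in> L"
proof -
  let ?c = "x ^ CARD('f) + \<theta> * x"
  let ?f = "monom 1 (CARD('f)) + [:- ?c, \<theta>:]"
  have "pderiv ?f = [:\<theta>:]"
    by (simp add: pderiv_add pderiv_monom pderiv_pCons)
  then have "coprime ?f (pderiv ?f)"
    using theta_nonzero by (intro is_unit_right_imp_coprime) (simp add: is_unit_const_poly_iff dvd_field_iff)
  moreover have "degree ?f = CARD('f)"
    using q_ge_2 by (subst degree_add_eq_left) (auto simp: degree_monom_eq)
  moreover have "Polynomial.coeff ?f i \<in> L" for i
    using uminus_mem[OF assms] by (auto simp: coeff_pCons split: nat.split intro!: add_mem)
  ultimately obtain y where y: "y \<in> L" "poly ?f y = 0"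
    using q_ge_2 separable_root[of ?f] by (metis less_le_trans zero_less_numeral)
  define z where "z = (x - y) / lam"
  have "(x - y) ^ CARD('f) = - \<theta> * (x - y)"
    using y(2) frobenius_add[of "x - y" y] by (simp add: poly_monom algebra_simps)
  then have "z ^ CARD('f) = z"
    by (simp add: z_def power_divide lam_power_q)
  then obtain a where "z = Fq j a"
    by (auto simp: frob_fixed_iff)
  then have "x = y + Fq j a * lam"
    by (simp add: z_def field_simps)
  then show ?thesis
    using y(1) by (simp add: add_mem mult_mem)
qed

section \<open>Series over F_q and the twist equation in rank one\<close>

sublocale Fq_on: ring_hom_on UNIV "Fq j"
  by unfold_locales (simp_all add: Fq.hom_add Fq.hom_mult)

lemma Fq_fps_eq: "Fq_on.fps_map = Fq_fps j"
  by (simp add: fun_eq_iff fps_eq_iff Fq_fps_def)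

lemma Fq_fps_over [simp]: "f \<in> Fq_on.fps_over"
  by (simp add: Fq_on.fps_over_def)

lemma Fq_fps_nth [simp]: "fps_nth (Fq_fps j a) n = Fq j (fps_nth a n)"
  by (simp add: Fq_fps_def)

lemma Fq_fps_eq_iff [simp]: "Fq_fps j a = Fq_fps j b \<longleftrightarrow> a = b"
  by (simp add: fps_eq_iff)

lemma Fq_fps_mult: "Fq_fps j (a * b) = Fq_fps j a * Fq_fps j b"
  using Fq_on.fps_map_mult[of a b] by (simp add: Fq_fps_eq)

lemma Fq_fps_one [simp]: "Fq_fps j 1 = 1"
  by (simp add: fps_eq_iff)

lemma twist_Fq_fps: "frob.fps_map (Fq_fps j a) = Fq_fps j a"
  by (simp add: fps_eq_iff Fq_power)

lemma twist_fixed: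
  assumes "frob.fps_map f = f"
  obtains a where "f = Fq_fps j a"
proof
  have "fps_nth f n \<in> range (Fq j)" for n
    using arg_cong[OF assms, of "\<lambda>f. fps_nth f n"] by (simp add: frob_fixed_iff)
  then show "f = Fq_fps j (Abs_fps (\<lambda>n. inv_into UNIV (Fq j) (fps_nth f n)))"
    by (simp add: fps_eq_iff f_inv_into_f)
qed

definition t_theta :: "'c fps" where
  "t_theta = fps_X - fps_const \<theta>"

definition omega_t :: "'c fps" where
  "omega_t = omega j v lam"

lemma omega_nth_0 [simp]: "fps_nth omega_t 0 = lam"
  by (simp add: omega_t_def omega_nth omega_lim_0)

lemma omega_nonzero [simp]: "omega_t \<noteq> 0"
  using omega_nth_0 lam_nonzero by (metis fps_zero_nth)

lemma omega_inverse [simp]: "omega_t * inverse omega_t = 1" "inverse omega_t * omega_t = 1"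
  by (simp_all add: inverse_mult_eq_1 inverse_mult_eq_1')

lemma twist_omega: "frob.fps_map omega_t = t_theta * omega_t"
  using frob_omega[OF lam] by (simp add: omega_t_def t_theta_def)

lemma twist_one [simp]: "frob.fps_map 1 = 1"
  by (rule ring_hom_on.one[OF frob.ring_hom_on_fps])

lemma twist_mult: "frob.fps_map (f * g) = frob.fps_map f * frob.fps_map g"
  by (simp add: frob.fps_map_mult)

text \<open>The product of omega and its inverse is twisted, and omega is cancelled. In this form it
  shows that a solution of the twist equation becomes fixed by the twist after division by
  omega.\<close>

lemma twist_omega_inverse: "frob.fps_map (inverse omega_t) * t_theta = inverse omega_t"
proof -
  have "frob.fps_map (inverse omega_t) * t_theta * omega_t = inverse omega_t * omega_t"
    using twist_mult[of "inverse omega_t" omega_t] by (simp add: twist_omega mult.assoc)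
  then show ?thesis
    by (metis mult_right_cancel omega_nonzero)
qed

lemma twist_solution:
  assumes "frob.fps_map f = t_theta * f"
  obtains a where "f = Fq_fps j a * omega_t"
proof -
  have "frob.fps_map (f * inverse omega_t) = f * (frob.fps_map (inverse omega_t) * t_theta)"
    by (simp add: twist_mult assms mult_ac)
  then have "frob.fps_map (f * inverse omega_t) = f * inverse omega_t"
    by (simp only: twist_omega_inverse)
  then obtain a where a: "f * inverse omega_t = Fq_fps j a"
    by (rule twist_fixed)
  have "f = f * (inverse omega_t * omega_t)"
    by simp
  also have "\<dots> = Fq_fps j a * omega_t"
    by (simp only: a[symmetric] mult.assoc)
  finally show ?thesis
    by (rule that)
qed

text \<open>Coefficients are compared: t^0 gives a torsion condition and t^(n+1) a compatibility
  condition. The inhomogeneous term \<open>g\<close> will be the next coordinate of a vector in the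
  Tate module.\<close>

lemma twist_affine_iff:
  "frob.fps_map f = t_theta * f + g \<longleftrightarrow> fps_nth f 0 ^ CARD('f) + \<theta> * fps_nth f 0 - fps_nth g 0 = 0 \<and>
     (\<forall>n. fps_nth f (Suc n) ^ CARD('f) + \<theta> * fps_nth f (Suc n) - fps_nth g (Suc n) = fps_nth f n)"
proof -
  have all_nat: "(\<forall>n. P n) \<longleftrightarrow> P 0 \<and> (\<forall>n. P (Suc n))" for P :: "nat \<Rightarrow> bool"
    by (metis not0_implies_Suc)
  have nth: "fps_nth (t_theta * f + g) n =
      (case n of 0 \<Rightarrow> 0 | Suc m \<Rightarrow> fps_nth f m) - \<theta> * fps_nth f n + fps_nth g n" for n
    by (cases n) (simp_all add: t_theta_def left_diff_distrib)
  have "frob.fps_map f = t_theta * f + g \<longleftrightarrow> (\<forall>n. fps_nth f n ^ CARD('f) = fps_nth (t_theta * f + g) n)"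
    by (simp add: fps_eq_iff)
  also have "\<dots> \<longleftrightarrow> (\<forall>n. fps_nth f n ^ CARD('f) + \<theta> * fps_nth f n - fps_nth g n =
      (case n of 0 \<Rightarrow> 0 | Suc m \<Rightarrow> fps_nth f m))"
    unfolding nth by (auto simp: algebra_simps)
  also have "\<dots> \<longleftrightarrow> fps_nth f 0 ^ CARD('f) + \<theta> * fps_nth f 0 - fps_nth g 0 = 0 \<and>
     (\<forall>n. fps_nth f (Suc n) ^ CARD('f) + \<theta> * fps_nth f (Suc n) - fps_nth g (Suc n) = fps_nth f n)"
    by (subst all_nat) simp
  finally show ?thesis .
qed

lemma twist_eq_iff:
  "frob.fps_map f = t_theta * f \<longleftrightarrow> fps_nth f 0 ^ CARD('f) + \<theta> * fps_nth f 0 = 0 \<and>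
     (\<forall>n. fps_nth f (Suc n) ^ CARD('f) + \<theta> * fps_nth f (Suc n) = fps_nth f n)"
  using twist_affine_iff[of f 0] by simp

text \<open>Starting from \<open>lam\<close>, each coefficient solves x^q + theta x = c with c the
  preceding one.\<close>

lemma omega_mem: "fps_nth omega_t n \<in> L"
proof (induction n)
  case (Suc n)
  have "fps_nth omega_t (Suc n) ^ CARD('f) + \<theta> * fps_nth omega_t (Suc n) = fps_nth omega_t n"
    using twist_omega twist_eq_iff by blast
  then show ?case
    using Suc.IH torsion_root_mem by metis
qed simp

section \<open>The t-action and its compatible systems\<close>

lemma Phi_t_carrier [simp, intro]: "x \<in> carrier_vec (Suc k) \<Longrightarrow> Phi_t j k x \<in> carrier_vec (Suc k)"
  unfolding Phi_t_def N_mat_def by (intro add_carrier_vec mult_mat_vec_carrier) auto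

lemma Phi_t_index:
  assumes "x \<in> carrier_vec (Suc k)" "i < Suc k"
  shows "Phi_t j k x $ i = x $ i ^ CARD('f) + \<theta> * x $ i - (if i < k then x $ Suc i else 0)"
proof -
  have "(N_mat j k *\<^sub>v x) $ i = (\<Sum>l<Suc k. (if i = l then \<theta> else if l = Suc i then - 1 else 0) * x $ l)"
    using assms by (simp add: N_mat_def scalar_prod_def atLeast0LessThan del: sum.lessThan_Suc)
  also have "\<dots> = (\<Sum>l<Suc k. (if l = i then \<theta> * x $ l else 0) - (if l = Suc i then x $ l else 0))"
    by (intro sum.cong) auto
  also have "\<dots> = \<theta> * x $ i - (if i < k then x $ Suc i else 0)"
    using assms by (simp add: sum_subtractf del: sum.lessThan_Suc)
  finally show ?thesis
    using assms by (simp add: Phi_t_def N_mat_def)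
qed

lemma Phi_t_zero: "Phi_t j k (0\<^sub>v (Suc k)) = 0\<^sub>v (Suc k)"
proof (rule eq_vecI)
  show "dim_vec (Phi_t j k (0\<^sub>v (Suc k))) = dim_vec (0\<^sub>v (Suc k) :: 'c vec)"
    using Phi_t_carrier[of "0\<^sub>v (Suc k)" k] by (metis carrier_vecD zero_carrier_vec)
qed (use q_ge_2 in \<open>simp add: Phi_t_index power_0_left\<close>)

lemma funpow_Phi_t_carrier:
  "x \<in> carrier_vec (Suc k) \<Longrightarrow> (Phi_t j k ^^ n) x \<in> carrier_vec (Suc k)"
  by (induction n) auto

lemma Phi_monom:
  assumes "x \<in> carrier_vec (Suc k)"
  shows "Phi j k (monom 1 n) x = (Phi_t j k ^^ n) x"
proof (rule eq_vecI)
  have dim: "dim_vec ((Phi_t j k ^^ n) x) = Suc k"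
    using funpow_Phi_t_carrier[OF assms] by (rule carrier_vecD)
  then show "dim_vec (Phi j k (monom 1 n) x) = dim_vec ((Phi_t j k ^^ n) x)"
    by (simp add: Phi_def)
  fix i assume "i < dim_vec ((Phi_t j k ^^ n) x)"
  then have "Phi j k (monom 1 n) x $ i =
      (\<Sum>m\<le>n. Fq j (if n = m then 1 else 0) * (Phi_t j k ^^ m) x $ i)"
    using dim by (simp add: Phi_def degree_monom_eq)
  also have "\<dots> = (\<Sum>m\<le>n. if m = n then (Phi_t j k ^^ m) x $ i else 0)"
    by (intro sum.cong) auto
  finally show "Phi j k (monom 1 n) x $ i = (Phi_t j k ^^ n) x $ i"
    by simp
qed

text \<open>If t kills e_0 and t e_(n+1) = e_n for all n, then t^(n+1) kills e_n by
  induction.\<close>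

lemma tate_module_iff:
  "e \<in> tate_module j k \<longleftrightarrow> (\<forall>n. e n \<in> carrier_vec (Suc k)) \<and>
     Phi_t j k (e 0) = 0\<^sub>v (Suc k) \<and> (\<forall>n. Phi_t j k (e (Suc n)) = e n)"
proof -
  have "e \<in> tate_module j k \<longleftrightarrow> (\<forall>n. e n \<in> carrier_vec (Suc k)) \<and>
     (\<forall>n. (Phi_t j k ^^ Suc n) (e n) = 0\<^sub>v (Suc k)) \<and> (\<forall>n. Phi_t j k (e (Suc n)) = e n)"
  proof (cases "\<forall>n. e n \<in> carrier_vec (Suc k)")
    case True
    have "Phi j k (monom 1 1) (e n) = Phi_t j k (e n)" for n
      using Phi_monom[of "e n" k 1] True by simp
    then show ?thesis
      using True by (auto simp: tate_module_def torsion_def Phi_monom simp del: funpow.simps(2))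
  next
    case False
    then show ?thesis
      by (auto simp: tate_module_def torsion_def)
  qed
  moreover have "(Phi_t j k ^^ Suc n) (e n) = 0\<^sub>v (Suc k)"
    if "Phi_t j k (e 0) = 0\<^sub>v (Suc k)" "\<forall>n. Phi_t j k (e (Suc n)) = e n" for n
    by (induction n) (use that in \<open>simp_all add: funpow_Suc_right del: funpow.simps(2)\<close>)
  moreover have "Phi_t j k (e 0) = 0\<^sub>v (Suc k)" if "\<forall>n. (Phi_t j k ^^ Suc n) (e n) = 0\<^sub>v (Suc k)"
    using that[rule_format, of 0] by simp
  ultimately show ?thesis
    by blast
qed

lemma funpow_Phi_t_tate:
  assumes "e \<in> tate_module j k"
  shows "(Phi_t j k ^^ m) (e n) = (if m \<le> n then e (n - m) else 0\<^sub>v (Suc k))"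
proof (induction m)
  case (Suc m)
  have e: "Phi_t j k (e 0) = 0\<^sub>v (Suc k)" "Phi_t j k (e (Suc i)) = e i" for i
    using assms by (simp_all add: tate_module_iff)
  consider "m < n" | "m = n" | "n < m"
    by linarith
  then show ?case
  proof cases
    case 1
    then have "n - m = Suc (n - Suc m)"
      by simp
    then show ?thesis
      using 1 Suc.IH e(2)[of "n - Suc m"] by simp
  qed (use Suc.IH e in \<open>simp_all add: Phi_t_zero\<close>)
qed simp

lemma coeff_seq_index: "i < dim_vec w \<Longrightarrow> coeff_seq w n $ i = fps_nth (w $ i) n"
  by (simp add: coeff_seq_def)

lemma coeff_seq_carrier [simp]: "coeff_seq w n \<in> carrier_vec m \<longleftrightarrow> w \<in> carrier_vec m"
  by (simp add: coeff_seq_def)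

lemma coeff_seq_inj:
  assumes "coeff_seq w = coeff_seq w'"
  shows "w = w'"
proof (rule eq_vecI)
  show dim: "dim_vec w = dim_vec w'"
    using arg_cong[OF assms, of "\<lambda>e. dim_vec (e 0)"] by (simp add: coeff_seq_def)
  show "w $ i = w' $ i" if "i < dim_vec w'" for i
  proof (rule fps_ext)
    show "fps_nth (w $ i) n = fps_nth (w' $ i) n" for n
      using arg_cong[OF assms, of "\<lambda>e. e n $ i"] that dim by (simp add: coeff_seq_index)
  qed
qed

text \<open>The first hyperderivative of t - theta is 1 and the higher ones are 0, so its matrix is
  bidiagonal.\<close>

lemma rho_t_theta_index:
  assumes "w \<in> carrier_vec (Suc k)" "i < Suc k"
  shows "(rho_mat k t_theta *\<^sub>v w) $ i = t_theta * w $ i + (if i < k then w $ Suc i else 0)"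
proof -
  have h: "hyperderiv n t_theta = (if n = 0 then t_theta else if n = 1 then 1 else 0)" for n
    by (auto simp: fps_eq_iff fps_nth_hyperderiv t_theta_def fps_X_nth)
  have "(rho_mat k t_theta *\<^sub>v w) $ i = (\<Sum>l<Suc k. rho_mat k t_theta $$ (i, l) * w $ l)"
    using assms by (simp add: scalar_prod_def atLeast0LessThan del: sum.lessThan_Suc)
  also have "\<dots> = (\<Sum>l<Suc k. (if l = i then t_theta * w $ l else 0) + (if l = Suc i then w $ l else 0))"
    using assms(2) by (intro sum.cong) (auto simp: rho_mat_index h)
  finally show ?thesis
    using assms(2) by (simp add: sum.distrib del: sum.lessThan_Suc)
qed

text \<open>This is \<open>twist_affine_iff\<close> in each coordinate. The -1 on the superdiagonal
  of \<open>N_mat\<close> moves to the other side of the equation and becomes the first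
  hyperderivative 1 of t - theta.\<close>

lemma coeff_seq_tate_iff:
  assumes w: "w \<in> carrier_vec (Suc k)"
  shows "coeff_seq w \<in> tate_module j k \<longleftrightarrow> map_vec frob.fps_map w = rho_mat k t_theta *\<^sub>v w"
proof -
  \<comment> \<open>The last coordinate has no successor; the value 0 reflects this.\<close>
  let ?next = "\<lambda>i. if i < k then w $ Suc i else 0"
  have next_nth: "(if i < k then coeff_seq w n $ Suc i else 0) = fps_nth (?next i) n" for i n
    using w by (simp add: coeff_seq_index)
  have eq: "x = y \<longleftrightarrow> (\<forall>i<Suc k. x $ i = y $ i)" if "x \<in> carrier_vec (Suc k)" "y \<in> carrier_vec (Suc k)"
    for x y :: "'a vec"
    using that by (auto intro!: eq_vecI)
  have "coeff_seq w \<in> tate_module j k \<longleftrightarrow>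
      Phi_t j k (coeff_seq w 0) = 0\<^sub>v (Suc k) \<and> (\<forall>n. Phi_t j k (coeff_seq w (Suc n)) = coeff_seq w n)"
    using w by (simp add: tate_module_iff)
  also have "Phi_t j k (coeff_seq w 0) = 0\<^sub>v (Suc k) \<longleftrightarrow>
      (\<forall>i<Suc k. fps_nth (w $ i) 0 ^ CARD('f) + \<theta> * fps_nth (w $ i) 0 - fps_nth (?next i) 0 = 0)"
    using w by (subst eq) (simp_all add: Phi_t_index next_nth coeff_seq_index del: Suc_eq_plus1)
  also have "(\<forall>n. Phi_t j k (coeff_seq w (Suc n)) = coeff_seq w n) \<longleftrightarrow>
      (\<forall>i<Suc k. \<forall>n. fps_nth (w $ i) (Suc n) ^ CARD('f) + \<theta> * fps_nth (w $ i) (Suc n) -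
         fps_nth (?next i) (Suc n) = fps_nth (w $ i) n)"
    using w by (subst eq) (auto simp add: Phi_t_index next_nth coeff_seq_index)
  also have "(\<forall>i<Suc k. fps_nth (w $ i) 0 ^ CARD('f) + \<theta> * fps_nth (w $ i) 0 - fps_nth (?next i) 0 = 0) \<and>
      (\<forall>i<Suc k. \<forall>n. fps_nth (w $ i) (Suc n) ^ CARD('f) + \<theta> * fps_nth (w $ i) (Suc n) -
         fps_nth (?next i) (Suc n) = fps_nth (w $ i) n) \<longleftrightarrow>
      (\<forall>i<Suc k. frob.fps_map (w $ i) = t_theta * w $ i + ?next i)"
    unfolding twist_affine_iff by blast
  also have "\<dots> \<longleftrightarrow> map_vec frob.fps_map w = rho_mat k t_theta *\<^sub>v w"
    using w mult_mat_vec_carrier[OF rho_mat_carrier w, of t_theta]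
    by (subst eq) (auto simp: rho_t_theta_index simp del: index_mult_mat_vec)
  finally show ?thesis .
qed

end

section \<open>The basis formed by the columns of rho(omega)\<close>

context carlitz
begin

lemma tate_module_cases:
  assumes "e \<in> tate_module j k"
  obtains w where "w \<in> carrier_vec (Suc k)" "e = coeff_seq w"
proof
  let ?w = "vec (Suc k) (\<lambda>i. Abs_fps (\<lambda>n. e n $ i))"
  have "dim_vec (e n) = Suc k" for n
    using assms by (simp add: tate_module_iff carrier_vecD)
  then show "e = coeff_seq ?w"
    by (intro ext eq_vecI) (simp_all add: coeff_seq_def)
qed simp

text \<open>Since t^m shifts a compatible system down by m places, acting by \<open>a\<close> modulo
  t^(n+1) gives a Cauchy product: scalar multiplication on the Tate module becomes multiplication of
  power series.\<close>

lemma tate_smult_coeff_seq: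
  assumes w: "w \<in> carrier_vec (Suc k)" and e: "coeff_seq w \<in> tate_module j k" and i: "i < Suc k"
  shows "tate_smult j k a (coeff_seq w) n $ i = fps_nth (Fq_fps j a * w $ i) n"
proof -
  let ?p = "\<Sum>m\<le>n. monom (fps_nth a m) m"
  have coeff: "Polynomial.coeff ?p m = (if m \<le> n then fps_nth a m else 0)" for m
    by (simp add: coeff_sum)
  have "degree ?p \<le> n"
    by (intro degree_le allI impI) (simp add: coeff)
  then have "(\<Sum>m\<le>degree ?p. Fq j (Polynomial.coeff ?p m) * ((Phi_t j k ^^ m) (coeff_seq w n) $ i)) =
      (\<Sum>m\<le>n. Fq j (Polynomial.coeff ?p m) * ((Phi_t j k ^^ m) (coeff_seq w n) $ i))"
    by (intro sum.mono_neutral_left) (auto simp: coeff_eq_0 not_le)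
  also have "\<dots> = (\<Sum>m\<le>n. Fq j (fps_nth a m) * fps_nth (w $ i) (n - m))"
    using w i by (intro sum.cong) (auto simp: coeff funpow_Phi_t_tate[OF e] coeff_seq_index)
  finally show ?thesis
    using i by (simp add: tate_smult_def Phi_def fps_mult_nth atLeast0AtMost)
qed

lemma tate_lincomb_coeff_seq:
  assumes M: "M \<in> carrier_mat (Suc k) (Suc k)"
    and b: "\<And>l. l < Suc k \<Longrightarrow> b l = coeff_seq (col M l) \<and> b l \<in> tate_module j k"
    and c: "c \<in> carrier_vec (Suc k)"
  shows "tate_lincomb j k b c = coeff_seq (M *\<^sub>v map_vec (Fq_fps j) c)"
proof
  fix n
  show "tate_lincomb j k b c n = coeff_seq (M *\<^sub>v map_vec (Fq_fps j) c) n"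
  proof (rule eq_vecI)
    show "dim_vec (tate_lincomb j k b c n) = dim_vec (coeff_seq (M *\<^sub>v map_vec (Fq_fps j) c) n)"
      using M by (simp add: tate_lincomb_def coeff_seq_def)
    fix i assume "i < dim_vec (coeff_seq (M *\<^sub>v map_vec (Fq_fps j) c) n)"
    then have i: "i < Suc k"
      using M by (simp add: coeff_seq_def)
    have "tate_lincomb j k b c n $ i = (\<Sum>l<Suc k. tate_smult j k (c $ l) (b l) n $ i)"
      using i by (simp add: tate_lincomb_def)
    also have "\<dots> = (\<Sum>l<Suc k. fps_nth (M $$ (i, l) * Fq_fps j (c $ l)) n)"
    proof (rule sum.cong)
      fix l assume "l \<in> {..<Suc k}"
      then have l: "l < Suc k"
        by simp
      then have "col M l \<in> carrier_vec (Suc k)" "col M l $ i = M $$ (i, l)"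
        using M i by auto
      then show "tate_smult j k (c $ l) (b l) n $ i = fps_nth (M $$ (i, l) * Fq_fps j (c $ l)) n"
        using b[OF l] i tate_smult_coeff_seq[of "col M l" k i "c $ l" n] by (metis mult.commute)
    qed simp
    also have "\<dots> = coeff_seq (M *\<^sub>v map_vec (Fq_fps j) c) n $ i"
      using M c i by (simp add: coeff_seq_index scalar_prod_def fps_sum_nth atLeast0LessThan
          del: sum.lessThan_Suc)
    finally show "tate_lincomb j k b c n $ i = coeff_seq (M *\<^sub>v map_vec (Fq_fps j) c) n $ i" .
  qed
qed

abbreviation omega_mat :: "nat \<Rightarrow> 'c fps mat" where
  "omega_mat k \<equiv> rho_mat k omega_t"

lemma omega_basis_eq: "omega_basis j v lam k l = coeff_seq (col (omega_mat k) l)"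
  by (simp add: omega_basis_def omega_t_def)

lemma rho_mat_mult_vec_carrier:
  "w \<in> carrier_vec (Suc k) \<Longrightarrow> rho_mat k f *\<^sub>v w \<in> carrier_vec (Suc k)"
  by (rule mult_mat_vec_carrier[OF rho_mat_carrier])

lemma rho_mat_mult_vec:
  "w \<in> carrier_vec (Suc k) \<Longrightarrow> rho_mat k f *\<^sub>v (rho_mat k g *\<^sub>v w) = rho_mat k (f * g) *\<^sub>v w"
  by (simp add: rho_mat_mult del: index_mult_mat_vec)
     (rule assoc_mult_mat_vec[OF rho_mat_carrier rho_mat_carrier, symmetric])

lemma rho_mat_one_vec: "w \<in> carrier_vec (Suc k) \<Longrightarrow> rho_mat k 1 *\<^sub>v w = w"
  by (simp add: rho_mat_1)

lemma map_twist_rho: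
  assumes "w \<in> carrier_vec (Suc k)"
  shows "map_vec frob.fps_map (rho_mat k f *\<^sub>v w) =
    rho_mat k (frob.fps_map f) *\<^sub>v map_vec frob.fps_map w"
  using ring_hom_on.map_mult_mat_vec[OF frob.ring_hom_on_fps rho_mat_carrier assms, of f]
  by (simp add: frob.map_rho_mat)

lemma map_Fq_rho:
  assumes "c \<in> carrier_vec (Suc k)"
  shows "map_vec (Fq_fps j) (rho_mat k f *\<^sub>v c) = rho_mat k (Fq_fps j f) *\<^sub>v map_vec (Fq_fps j) c"
  using ring_hom_on.map_mult_mat_vec[OF Fq_on.ring_hom_on_fps rho_mat_carrier assms, of f]
  using Fq_on.map_rho_mat[of f k] by (simp add: Fq_fps_eq)

text \<open>The coordinates \<open>c\<close> are fixed by the twist, so the twist of rho(omega) c is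
  rho((t - theta) omega) c, which is rho(t - theta) applied to rho(omega) c.\<close>

lemma tate_module_omega:
  assumes c: "c \<in> carrier_vec (Suc k)"
  shows "coeff_seq (omega_mat k *\<^sub>v map_vec (Fq_fps j) c) \<in> tate_module j k"
proof -
  have c': "map_vec (Fq_fps j) c \<in> carrier_vec (Suc k)"
    using c by simp
  have "map_vec frob.fps_map (map_vec (Fq_fps j) c) = map_vec (Fq_fps j) c"
    by (rule eq_vecI) (simp_all add: twist_Fq_fps)
  then have "map_vec frob.fps_map (omega_mat k *\<^sub>v map_vec (Fq_fps j) c) =
      rho_mat k t_theta *\<^sub>v (omega_mat k *\<^sub>v map_vec (Fq_fps j) c)"
    by (simp only: map_twist_rho[OF c'] twist_omega rho_mat_mult_vec[OF c'])
  then show ?thesis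
    using coeff_seq_tate_iff mult_mat_vec_carrier[OF rho_mat_carrier c'] by blast
qed

lemma tate_module_omega_cases:
  assumes "e \<in> tate_module j k"
  obtains c where "c \<in> carrier_vec (Suc k)" "e = coeff_seq (omega_mat k *\<^sub>v map_vec (Fq_fps j) c)"
proof -
  obtain w where w: "w \<in> carrier_vec (Suc k)" "e = coeff_seq w"
    using tate_module_cases[OF assms] .
  then have tw: "map_vec frob.fps_map w = rho_mat k t_theta *\<^sub>v w"
    using assms coeff_seq_tate_iff by blast
  let ?d = "rho_mat k (inverse omega_t) *\<^sub>v w"
  have d: "?d \<in> carrier_vec (Suc k)"
    by (rule mult_mat_vec_carrier[OF rho_mat_carrier w(1)])
  have "map_vec frob.fps_map ?d = ?d"
    by (simp only: map_twist_rho[OF w(1)] tw rho_mat_mult_vec[OF w(1)] twist_omega_inverse)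
  then have fixed: "frob.fps_map (?d $ i) = ?d $ i" if "i < Suc k" for i
    using d that by (metis carrier_vecD index_map_vec(1))
  define c where "c = vec (Suc k) (\<lambda>i. SOME a. ?d $ i = Fq_fps j a)"
  have "map_vec (Fq_fps j) c = ?d"
  proof (rule eq_vecI)
    show "dim_vec (map_vec (Fq_fps j) c) = dim_vec ?d"
      using d by (simp add: c_def)
    fix i assume "i < dim_vec ?d"
    then have i: "i < Suc k"
      using d by (simp add: carrier_vecD)
    then obtain a where "?d $ i = Fq_fps j a"
      using twist_fixed fixed by blast
    then have "?d $ i = Fq_fps j (SOME a. ?d $ i = Fq_fps j a)"
      by (rule someI)
    then show "map_vec (Fq_fps j) c $ i = ?d $ i"
      using i by (simp add: c_def)
  qed
  then have "omega_mat k *\<^sub>v map_vec (Fq_fps j) c = w"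
    by (simp only: rho_mat_mult_vec[OF w(1)] omega_inverse rho_mat_one_vec[OF w(1)])
  then show ?thesis
    using that[of c] w(2) by (simp add: c_def)
qed

lemma omega_coordinates_unique:
  assumes c: "c \<in> carrier_vec (Suc k)" "c' \<in> carrier_vec (Suc k)"
    and eq: "omega_mat k *\<^sub>v map_vec (Fq_fps j) c = omega_mat k *\<^sub>v map_vec (Fq_fps j) c'"
  shows "c = c'"
proof -
  have "rho_mat k (inverse omega_t) *\<^sub>v (omega_mat k *\<^sub>v map_vec (Fq_fps j) d) = map_vec (Fq_fps j) d"
    if "d \<in> carrier_vec (Suc k)" for d
    using that rho_mat_mult_vec[of "map_vec (Fq_fps j) d" k "inverse omega_t" omega_t]
    by (simp add: rho_mat_one_vec del: index_mult_mat_vec)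
  then have eq': "map_vec (Fq_fps j) c = map_vec (Fq_fps j) c'"
    using c eq by metis
  show ?thesis
  proof (rule eq_vecI)
    show "dim_vec c = dim_vec c'"
      using c by (metis carrier_vecD)
    show "c $ i = c' $ i" if "i < dim_vec c'" for i
      using arg_cong[OF eq', of "\<lambda>x. x $ i"] that c by (simp add: carrier_vecD)
  qed
qed

lemma mat_mult_unit_vec:
  fixes A :: "'a::comm_ring_1 mat"
  assumes "A \<in> carrier_mat m n" "l < n"
  shows "A *\<^sub>v unit_vec n l = col A l"
  using assms by (intro eq_vecI) auto

lemma omega_basis_tate:
  assumes "l < Suc k"
  shows "omega_basis j v lam k l \<in> tate_module j k"
proof -
  have "map_vec (Fq_fps j) (unit_vec (Suc k) l) = unit_vec (Suc k) l"
    by (rule eq_vecI) (auto simp: unit_vec_def fps_eq_iff)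
  then show ?thesis
    using tate_module_omega[of "unit_vec (Suc k) l" k]
      mat_mult_unit_vec[OF rho_mat_carrier assms, of omega_t]
    by (simp add: omega_basis_eq)
qed

lemma tate_lincomb_omega:
  "c \<in> carrier_vec (Suc k) \<Longrightarrow>
    tate_lincomb j k (omega_basis j v lam k) c = coeff_seq (omega_mat k *\<^sub>v map_vec (Fq_fps j) c)"
  by (rule tate_lincomb_coeff_seq) (auto simp: omega_basis_tate, simp add: omega_basis_eq)

theorem omega_basis_is_tate_basis: "is_tate_basis j k (omega_basis j v lam k)"
  unfolding is_tate_basis_def
proof (intro conjI allI impI ballI)
  fix l assume "l < k + 1"
  then show "omega_basis j v lam k l \<in> tate_module j k"
    by (simp add: omega_basis_tate)
next
  fix c :: "'f fps vec" assume "c \<in> carrier_vec (k + 1)"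
  then show "tate_lincomb j k (omega_basis j v lam k) c \<in> tate_module j k"
    by (simp add: tate_lincomb_omega tate_module_omega)
next
  fix e assume "e \<in> tate_module j k"
  then obtain c where c: "c \<in> carrier_vec (Suc k)"
    "e = coeff_seq (omega_mat k *\<^sub>v map_vec (Fq_fps j) c)"
    by (rule tate_module_omega_cases)
  show "\<exists>!c. c \<in> carrier_vec (k + 1) \<and> e = tate_lincomb j k (omega_basis j v lam k) c"
  proof (rule ex1I[of _ c])
    show "c \<in> carrier_vec (k + 1) \<and> e = tate_lincomb j k (omega_basis j v lam k) c"
      using c by (simp add: tate_lincomb_omega)
    fix d assume d: "d \<in> carrier_vec (k + 1) \<and> e = tate_lincomb j k (omega_basis j v lam k) d"
    then have eq: "coeff_seq (omega_mat k *\<^sub>v map_vec (Fq_fps j) d) =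
        coeff_seq (omega_mat k *\<^sub>v map_vec (Fq_fps j) c)"
      using c(2) tate_lincomb_omega[of d k] by simp
    show "d = c"
      using omega_coordinates_unique[OF _ c(1) coeff_seq_inj[OF eq]] d by simp
  qed
qed

sublocale L: ring_hom_on L id
  by unfold_locales (simp_all add: add_mem uminus_mem mult_mem)

lemma omega_over: "omega_t \<in> L.fps_over"
  by (simp add: L.fps_over_def omega_mem)

lemma Fq_fps_over_L: "Fq_fps j a \<in> L.fps_over"
  by (simp add: L.fps_over_def)

text \<open>The entries are sums of hyperderivatives of omega times series over F_q, all with
  coefficients in \<open>L\<close>. Hence automorphisms of \<open>L\<close> can act on the Tate
  module.\<close>

theorem tate_module_mem:
  assumes "e \<in> tate_module j k" "i < Suc k"
  shows "e n $ i \<in> L"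
proof -
  obtain c where c: "c \<in> carrier_vec (Suc k)" "e = coeff_seq (omega_mat k *\<^sub>v map_vec (Fq_fps j) c)"
    using tate_module_omega_cases[OF assms(1)] .
  have "(omega_mat k *\<^sub>v map_vec (Fq_fps j) c) $ i =
      (\<Sum>l = 0..<Suc k. omega_mat k $$ (i, l) * Fq_fps j (c $ l))"
    using c(1) assms(2) by (simp add: scalar_prod_def del: sum.op_ivl_Suc)
  also have "\<dots> \<in> L.fps_over"
    using assms(2)
    by (intro ring_hom_on.sum_mem[OF L.ring_hom_on_fps] L.fps_over_mult L.rho_mat_mem omega_over
        Fq_fps_over_L) auto
  finally show ?thesis
    using c assms(2) by (simp add: coeff_seq_index L.fps_over_nth del: index_mult_mat_vec)
qed

end

section \<open>The action of one Galois element\<close>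

locale carlitz_gal = carlitz j v L lam
  for j :: "'f::{finite,field} fls alg_closure \<Rightarrow> 'c::field" and v L lam +
  fixes \<gamma> :: "'c \<Rightarrow> 'c"
  assumes \<gamma>: "\<gamma> \<in> carrier (Gal L (K_field j))"
begin

lemma gal_add: "x \<in> L \<Longrightarrow> y \<in> L \<Longrightarrow> \<gamma> (x + y) = \<gamma> x + \<gamma> y"
  and gal_mult: "x \<in> L \<Longrightarrow> y \<in> L \<Longrightarrow> \<gamma> (x * y) = \<gamma> x * \<gamma> y"
  and gal_fixed: "x \<in> K_field j \<Longrightarrow> \<gamma> x = x"
  and gal_bij: "bij_betw \<gamma> L L"
  using \<gamma> by (auto simp: Gal_def Bij_def)

lemma gal_mem: "x \<in> L \<Longrightarrow> \<gamma> x \<in> L"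
  using gal_bij by (auto simp: bij_betw_def)

lemma gal_Fq [simp]: "\<gamma> (Fq j a) = Fq j a" and gal_theta [simp]: "\<gamma> \<theta> = \<theta>"
  by (simp_all add: gal_fixed)

lemma gal_one: "\<gamma> 1 = 1"
  by (metis Fq.hom_one gal_Fq)

lemma gal_ring_hom_on: "ring_hom_on L \<gamma>"
  by (rule ring_hom_on.intro)
     (simp_all add: gal_add gal_mult gal_one add_mem uminus_mem mult_mem)

sublocale gal: ring_hom_on L \<gamma>
  by (rule gal_ring_hom_on)

lemma gal_fps_eq: "gal_fps \<gamma> = gal.fps_map"
  by (simp add: fun_eq_iff fps_eq_iff gal_fps_def)

lemma gal_Fq_fps: "gal_fps \<gamma> (Fq_fps j a) = Fq_fps j a"
  by (simp add: gal_fps_eq fps_eq_iff)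

lemma gal_fps_mult: "f \<in> L.fps_over \<Longrightarrow> g \<in> L.fps_over \<Longrightarrow> gal_fps \<gamma> (f * g) = gal_fps \<gamma> f * gal_fps \<gamma> g"
  by (simp add: gal_fps_eq gal.fps_map_mult)

lemma gal_omega_nth_0: "\<gamma> lam \<noteq> 0"
proof
  assume "\<gamma> lam = 0"
  then have "\<gamma> lam = \<gamma> 0"
    by simp
  then have "lam = 0"
    using gal_bij inj_on_eq_iff[of \<gamma> L lam 0] by (simp add: bij_betw_def)
  then show False
    by simp
qed

text \<open>Since \<open>\<gamma>\<close> commutes with x -> x^q + theta x, the image of omega
  solves the equation of omega. The resulting factor is a unit because the constant term of the
  image, which is the image of \<open>lam\<close>, is nonzero.\<close>

lemma gal_omega: "\<exists>!u. u dvd 1 \<and> gal_fps \<gamma> omega_t = Fq_fps j u * omega_t"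
proof -
  have "frob.fps_map (gal_fps \<gamma> omega_t) = t_theta * gal_fps \<gamma> omega_t"
  proof -
    have *: "\<gamma> x ^ CARD('f) + \<theta> * \<gamma> x = \<gamma> (x ^ CARD('f) + \<theta> * x)" if "x \<in> L" for x
      using that by (simp add: gal_add gal_mult gal.power power_mem mult_mem)
    show ?thesis
      using twist_omega unfolding twist_eq_iff by (simp add: gal_fps_def * omega_mem)
  qed
  then obtain u where u: "gal_fps \<gamma> omega_t = Fq_fps j u * omega_t"
    by (rule twist_solution)
  have "\<gamma> lam = Fq j (fps_nth u 0) * lam"
    using arg_cong[OF u, of "\<lambda>f. fps_nth f 0"] by (simp add: gal_fps_def)
  then have "fps_nth u 0 \<noteq> 0"
    using gal_omega_nth_0 by auto
  then have "u dvd 1"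
    by (simp add: fps_is_unit_iff)
  moreover have "u' = u" if "gal_fps \<gamma> omega_t = Fq_fps j u' * omega_t" for u'
    using that u by simp
  ultimately show ?thesis
    using u by blast
qed

abbreviation "u \<equiv> galois_char j v lam \<gamma>"

lemma gal_char_unit: "u dvd 1" and gal_char: "gal_fps \<gamma> omega_t = Fq_fps j u * omega_t"
  using theI'[OF gal_omega] unfolding galois_char_def omega_t_def by blast+

lemma gal_char_unique: "gal_fps \<gamma> omega_t = Fq_fps j u' * omega_t \<Longrightarrow> u = u'"
  using gal_char by simp

lemma gal_tate_coeff_seq: "gal_tate \<gamma> (coeff_seq w) = coeff_seq (map_vec (gal_fps \<gamma>) w)"
  by (intro ext eq_vecI) (simp_all add: gal_tate_def coeff_seq_def gal_fps_def)

lemma gal_tate_omega: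
  assumes c: "c \<in> carrier_vec (Suc k)"
  shows "gal_tate \<gamma> (coeff_seq (omega_mat k *\<^sub>v map_vec (Fq_fps j) c)) =
    coeff_seq (omega_mat k *\<^sub>v map_vec (Fq_fps j) (rho_mat k u *\<^sub>v c))"
proof -
  have c': "map_vec (Fq_fps j) c \<in> carrier_vec (Suc k)"
    using c by simp
  have over: "\<And>i l. i < Suc k \<Longrightarrow> l < Suc k \<Longrightarrow> omega_mat k $$ (i, l) \<in> L.fps_over"
    "\<And>l. l < Suc k \<Longrightarrow> map_vec (Fq_fps j) c $ l \<in> L.fps_over"
    using c by (auto intro: L.rho_mat_mem omega_over Fq_fps_over_L)
  have fix_c: "map_vec (gal_fps \<gamma>) (map_vec (Fq_fps j) c) = map_vec (Fq_fps j) c"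
    by (rule eq_vecI) (simp_all add: gal_Fq_fps)
  have "map_vec (gal_fps \<gamma>) (omega_mat k *\<^sub>v map_vec (Fq_fps j) c) =
      map_mat (gal_fps \<gamma>) (omega_mat k) *\<^sub>v map_vec (gal_fps \<gamma>) (map_vec (Fq_fps j) c)"
    unfolding gal_fps_eq
    by (rule ring_hom_on.map_mult_mat_vec[OF gal.ring_hom_on_fps rho_mat_carrier c' over])
  \<comment> \<open>Omega is written first so that multiplicativity places rho(u) next to the
    coordinate vector, where it acts on \<open>c\<close>.\<close>
  also have "map_mat (gal_fps \<gamma>) (omega_mat k) = rho_mat k (omega_t * Fq_fps j u)"
    using gal.map_rho_mat[OF omega_over] gal_char by (simp add: gal_fps_eq mult.commute)
  also have "rho_mat k (omega_t * Fq_fps j u) *\<^sub>v map_vec (gal_fps \<gamma>) (map_vec (Fq_fps j) c) =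
      omega_mat k *\<^sub>v map_vec (Fq_fps j) (rho_mat k u *\<^sub>v c)"
    by (simp only: fix_c map_Fq_rho[OF c] rho_mat_mult_vec[OF c'])
  finally show ?thesis
    by (simp only: gal_tate_coeff_seq)
qed

lemma gal_tate_mem:
  assumes "e \<in> tate_module j k"
  shows "gal_tate \<gamma> e \<in> tate_module j k"
proof -
  obtain c where c: "c \<in> carrier_vec (Suc k)" "e = coeff_seq (omega_mat k *\<^sub>v map_vec (Fq_fps j) c)"
    using tate_module_omega_cases[OF assms] .
  then show ?thesis
    using tate_module_omega[OF mult_mat_vec_carrier[OF rho_mat_carrier c(1)]]
    by (simp only: gal_tate_omega)
qed

text \<open>Uniqueness of coordinates in the basis gives A c = rho(u) c for every \<open>c\<close>,
  and unit vectors read off the columns.\<close>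

lemma represents_iff: "represents j k (omega_basis j v lam k) \<gamma> A \<longleftrightarrow> A = rho_mat k u"
proof
  assume "A = rho_mat k u"
  then show "represents j k (omega_basis j v lam k) \<gamma> A"
    by (auto simp: represents_def tate_lincomb_omega gal_tate_omega rho_mat_mult_vec_carrier
        simp del: index_mult_mat_vec)
next
  assume "represents j k (omega_basis j v lam k) \<gamma> A"
  then have A: "A \<in> carrier_mat (Suc k) (Suc k)"
    and rep: "\<And>c. c \<in> carrier_vec (Suc k) \<Longrightarrow>
      gal_tate \<gamma> (tate_lincomb j k (omega_basis j v lam k) c) =
      tate_lincomb j k (omega_basis j v lam k) (A *\<^sub>v c)"
    by (auto simp: represents_def)
  have eq: "A *\<^sub>v c = rho_mat k u *\<^sub>v c" if c: "c \<in> carrier_vec (Suc k)" for c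
  proof -
    have Ac: "A *\<^sub>v c \<in> carrier_vec (Suc k)" and rc: "rho_mat k u *\<^sub>v c \<in> carrier_vec (Suc k)"
      using mult_mat_vec_carrier[OF A c] mult_mat_vec_carrier[OF rho_mat_carrier c] by auto
    have "coeff_seq (omega_mat k *\<^sub>v map_vec (Fq_fps j) (A *\<^sub>v c)) =
        coeff_seq (omega_mat k *\<^sub>v map_vec (Fq_fps j) (rho_mat k u *\<^sub>v c))"
      using rep[OF c] by (simp only: tate_lincomb_omega[OF c] tate_lincomb_omega[OF Ac] gal_tate_omega[OF c])
    then show ?thesis
      using omega_coordinates_unique[OF Ac rc] coeff_seq_inj by blast
  qed
  show "A = rho_mat k u"
  proof (rule mat_col_eqI)
    fix l assume "l < dim_col (rho_mat k u)"
    then have l: "l < Suc k"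
      by simp
    show "col A l = col (rho_mat k u) l"
      using eq[of "unit_vec (Suc k) l"] mat_mult_unit_vec[OF A l] mat_mult_unit_vec[OF rho_mat_carrier l]
      by simp
  qed (use A in auto)
qed

lemma tate_rep_eq: "tate_rep j k (omega_basis j v lam k) \<gamma> = rho_mat k u"
  by (simp add: tate_rep_def represents_iff)

end

section \<open>Irreducibility of the torsion polynomials\<close>

text \<open>The inner polynomial variable stands for theta, so this is reduction modulo the prime
  theta of the coefficients.\<close>

definition red0 :: "'a::field poly poly \<Rightarrow> 'a poly" where
  "red0 = map_poly (\<lambda>a. poly a 0)"

lemma coeff_red0: "Polynomial.coeff (red0 p) i = poly (Polynomial.coeff p i) 0"
  by (simp add: red0_def coeff_map_poly)

interpretation poly_0: comm_ring_hom "\<lambda>a. poly a (0::'a::comm_ring_1)"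
  by unfold_locales simp_all

interpretation map_poly_0: map_poly_comm_ring_hom "\<lambda>a. poly a (0::'a::comm_ring_1)" ..

lemma red0_mult: "red0 (p * r) = red0 p * red0 r"
  and red0_add: "red0 (p + r) = red0 p + red0 r"
  and red0_power: "red0 (p ^ n) = red0 p ^ n"
  by (simp_all add: red0_def map_poly_0.hom_mult map_poly_0.hom_add map_poly_0.hom_power)

lemma red0_smult: "red0 (Polynomial.smult c p) = Polynomial.smult (poly c 0) (red0 p)"
  by (rule poly_eqI) (simp add: coeff_red0)

lemma degree_red0_le: "degree (red0 p) \<le> degree p"
  unfolding red0_def by (rule degree_map_poly_le)

lemma red0_eq_0:
  assumes "red0 p = 0"
  obtains p' where "p = Polynomial.smult [:0, 1:] p'"
proof
  have dvd: "[:0, 1:] dvd Polynomial.coeff p i" for i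
    using arg_cong[OF assms, of "\<lambda>r. Polynomial.coeff r i"] poly_eq_0_iff_dvd[of "Polynomial.coeff p i" 0]
    by (simp add: coeff_red0)
  show "p = Polynomial.smult [:0, 1:] (map_poly (\<lambda>a. a div [:0, 1:]) p)"
    by (rule poly_eqI) (simp only: coeff_smult coeff_map_poly div_0 dvd_mult_div_cancel[OF dvd])
qed

text \<open>
  Eisenstein's criterion at the prime \<open>\<theta>\<close> of \<open>\<bbbF>\<^sub>q[\<theta>]\<close>, in a form that
  includes Gauss's lemma: the factorisation is allowed to have a denominator \<open>c\<close>.
\<close>

lemma eisenstein:
  fixes p :: "'a::field poly poly"
  assumes monic: "lead_coeff p = 1" and red: "red0 p = monom 1 (degree p)"
    and const: "Polynomial.coeff p 0 = [:0, 1:]"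
    and "r * g = Polynomial.smult c p" "c \<noteq> 0"
  shows "degree r = 0 \<or> degree g = 0"
  using assms(4,5)
proof (induction "degree c" arbitrary: c r g rule: less_induct)
  case less
  \<comment> \<open>If theta divides one of the factors, it divides \<open>c\<close>, because
    \<open>p\<close> is monic; cancelling it lowers the degree of \<open>c\<close>, on which the
    induction runs.\<close>
  have reduce: "\<exists>c'. s * h = Polynomial.smult c' p \<and> c' \<noteq> 0 \<and> degree c' < degree c"
    if "Polynomial.smult [:0, 1:] (s * h) = Polynomial.smult c p" for s h
  proof -
    define c' where "c' = Polynomial.coeff (s * h) (degree p)"
    have c: "c = [:0, 1:] * c'"
      using arg_cong[OF that, of "\<lambda>x. Polynomial.coeff x (degree p)"] monic
      by (simp add: c'_def)
    have "Polynomial.smult [:0, 1:] (s * h) = Polynomial.smult [:0, 1:] (Polynomial.smult c' p)"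
      using that by (simp add: c)
    then have "[:[:0, 1:]:] * (s * h) = [:[:0, 1:]:] * Polynomial.smult c' p"
      by simp
    then have "s * h = Polynomial.smult c' p"
      by (subst (asm) mult_left_cancel) auto
    moreover have "c' \<noteq> 0"
      using c less.prems(2) by auto
    moreover from this have "degree c' < degree c"
      unfolding c by (subst degree_mult_eq) auto
    ultimately show ?thesis
      by blast
  qed
  show ?case
  proof (cases "red0 r = 0 \<or> red0 g = 0")
    case True
    then consider r' where "r = Polynomial.smult [:0, 1:] r'" | g' where "g = Polynomial.smult [:0, 1:] g'"
      using red0_eq_0 by blast
    then show ?thesis
    proof cases
      case 1
      then obtain c' where "r' * g = Polynomial.smult c' p" "c' \<noteq> 0" "degree c' < degree c"
        using reduce[of r' g] less.prems(1) by auto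
      then show ?thesis
        using less.hyps[of c' r' g] 1 by simp
    next
      case 2
      then obtain c' where "r * g' = Polynomial.smult c' p" "c' \<noteq> 0" "degree c' < degree c"
        using reduce[of r g'] less.prems(1) by auto
      then show ?thesis
        using less.hyps[of c' r g'] 2 by simp
    qed
  next
    case False
    have "red0 r * red0 g = Polynomial.smult (poly c 0) (monom 1 (degree p))"
      using arg_cong[OF less.prems(1), of red0] by (simp add: red0_mult red0_smult red)
    then have prod: "red0 r * red0 g = monom (poly c 0) (degree p)"
      by (simp add: smult_monom)
    then have c0: "poly c 0 \<noteq> 0"
      using False by auto
    have "p \<noteq> 0"
      using monic by auto
    then have "degree (r * g) = degree p"
      using less.prems by simp
    moreover have "r \<noteq> 0" "g \<noteq> 0"
      using False by (auto simp: red0_def)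
    ultimately have deg: "degree r + degree g = degree p"
      by (simp add: degree_mult_eq)
    \<comment> \<open>Modulo theta the product is a nonzero constant times X^(deg p). The orders at
      0 of the reduced factors are bounded by the degrees and have the same sum, so they equal the
      degrees.\<close>
    have ord: "Polynomial.order 0 (red0 r) + Polynomial.order 0 (red0 g) = degree p"
      using order_mult[of "red0 r" "red0 g" 0] False c0 by (simp add: prod order_0_monom)
    have ord_le: "Polynomial.order 0 (red0 r) \<le> degree r" "Polynomial.order 0 (red0 g) \<le> degree g"
      using False order_degree degree_red0_le order_trans by metis+
    \<comment> \<open>Otherwise theta^2 would divide the constant term c theta of the product,
      contradicting that c is nonzero at 0.\<close>
    have "poly (Polynomial.coeff r 0) 0 \<noteq> 0 \<or> poly (Polynomial.coeff g 0) 0 \<noteq> 0"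
    proof (rule ccontr)
      assume "\<not> ?thesis"
      then obtain a b where ab: "Polynomial.coeff r 0 = [:0, 1:] * a" "Polynomial.coeff g 0 = [:0, 1:] * b"
        using poly_eq_0_iff_dvd[of "Polynomial.coeff r 0" 0] poly_eq_0_iff_dvd[of "Polynomial.coeff g 0" 0]
        by (auto elim!: dvdE)
      have "[:0, 1:] * (c - [:0, 1:] * (a * b)) = 0"
        using arg_cong[OF less.prems(1), of "\<lambda>x. Polynomial.coeff x 0"]
        by (simp add: coeff_mult ab const algebra_simps)
      then have "c = [:0, 1:] * (a * b)"
        by (simp only: mult_eq_0_iff) auto
      then show False
        using c0 by simp
    qed
    then have "poly (red0 r) 0 \<noteq> 0 \<or> poly (red0 g) 0 \<noteq> 0"
      by (simp add: poly_0_coeff_0 coeff_red0)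
    then have "Polynomial.order 0 (red0 r) = 0 \<or> Polynomial.order 0 (red0 g) = 0"
      using order_0I[of "red0 r" 0] order_0I[of "red0 g" 0] by auto
    then show ?thesis
      using ord ord_le deg by linarith
  qed
qed

text \<open>This is the Carlitz polynomial of t^n, the n-fold iterate of X -> X^q + theta X, with
  inner variable theta and outer variable X.\<close>

fun torsion_poly :: "nat \<Rightarrow> 'f::{finite,field} poly poly" where
  "torsion_poly 0 = [:0, 1:]"
| "torsion_poly (Suc n) = torsion_poly n ^ CARD('f) + Polynomial.smult [:0, 1:] (torsion_poly n)"

lemma torsion_poly_degree:
  "degree (torsion_poly n :: 'f::{finite,field} poly poly) = CARD('f) ^ n \<and>
   lead_coeff (torsion_poly n :: 'f poly poly) = 1"
proof (induction n)
  case (Suc n)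
  let ?p = "torsion_poly n :: 'f poly poly"
  have p: "?p \<noteq> 0" "lead_coeff ?p = 1" "degree ?p = CARD('f) ^ n"
    using Suc.IH by auto
  have deg: "degree (?p ^ CARD('f)) = CARD('f) ^ Suc n"
    using p by (simp add: degree_power_eq)
  have less: "degree (Polynomial.smult [:0, 1:] ?p) < degree (?p ^ CARD('f))"
    unfolding deg using p card_field_ge_2[where 'f='f] by simp
  have "degree (torsion_poly (Suc n) :: 'f poly poly) = degree (?p ^ CARD('f))"
    "lead_coeff (torsion_poly (Suc n) :: 'f poly poly) = lead_coeff (?p ^ CARD('f))"
    using degree_add_eq_left[OF less] lead_coeff_add_le[OF less]
    by (simp_all only: torsion_poly.simps add.commute)
  moreover have "lead_coeff (?p ^ CARD('f)) = 1"
    by (simp only: lead_coeff_power p(2) power_one)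
  ultimately show ?case
    by (simp only: deg)
qed simp

lemma torsion_poly_red0: "red0 (torsion_poly n :: 'f::{finite,field} poly poly) = monom 1 (CARD('f) ^ n)"
proof (induction n)
  case 0
  show ?case
    by (rule poly_eqI) (simp add: coeff_red0 coeff_pCons split: nat.split)
next
  case (Suc n)
  then show ?case
    by (simp add: red0_add red0_power red0_smult monom_power mult.commute)
qed

lemma torsion_poly_coeff_0: "Polynomial.coeff (torsion_poly n :: 'f::{finite,field} poly poly) 0 = 0"
  by (induction n) (use card_field_ge_2[where 'f='f] in \<open>auto simp: coeff_0_power power_0_left\<close>)

text \<open>This is the quotient of the Carlitz polynomials of t^(n+1) and t^n; its roots are the
  generators of the t^(n+1)-torsion.\<close>

definition primitive_torsion_poly :: "nat \<Rightarrow> 'f::{finite,field} poly poly" where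
  "primitive_torsion_poly n = torsion_poly n ^ (CARD('f) - 1) + [:[:0, 1:]:]"

text \<open>Modulo theta, \<open>torsion_poly n\<close> is a power of X, and its constant term is 0.
  As q - 1 > 0, the added theta is the whole constant term.\<close>

lemma primitive_torsion_poly_eisenstein:
  fixes n :: nat
  defines "p \<equiv> primitive_torsion_poly n :: 'f::{finite,field} poly poly"
  shows "lead_coeff p = 1" "red0 p = monom 1 (degree p)" "Polynomial.coeff p 0 = [:0, 1:]"
proof -
  let ?t = "torsion_poly n :: 'f poly poly"
  have q: "CARD('f) - 1 > 0"
    using card_field_ge_2[where 'f='f] by simp
  have t: "?t \<noteq> 0" "lead_coeff ?t = 1" "degree ?t = CARD('f) ^ n"
    using torsion_poly_degree[of n, where 'f='f] by auto
  have deg: "degree (?t ^ (CARD('f) - 1)) = CARD('f) ^ n * (CARD('f) - 1)"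
    using t by (simp add: degree_power_eq)
  then have less: "degree [:[:0, 1:]::'f poly:] < degree (?t ^ (CARD('f) - 1))"
    using q by simp
  have p: "degree p = degree (?t ^ (CARD('f) - 1))" "lead_coeff p = lead_coeff (?t ^ (CARD('f) - 1))"
    unfolding p_def primitive_torsion_poly_def
    using degree_add_eq_left[OF less] lead_coeff_add_le[OF less] by (simp_all only: add.commute)
  then show "lead_coeff p = 1"
    using t by (simp add: lead_coeff_power)
  have "red0 [:[:0, 1:]::'f poly:] = 0"
    by (simp add: red0_def)
  then show "red0 p = monom 1 (degree p)"
    unfolding p(1) deg unfolding p_def primitive_torsion_poly_def
    by (simp add: red0_add red0_power torsion_poly_red0 monom_power)
  show "Polynomial.coeff p 0 = [:0, 1:]"
    using q by (simp add: p_def primitive_torsion_poly_def torsion_poly_coeff_0 coeff_0_power power_0_left)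
qed

section \<open>Surjectivity of the Galois character\<close>

context carlitz
begin

definition A_val :: "'f poly \<Rightarrow> 'c" where
  "A_val a = poly (map_poly (Fq j) a) \<theta>"

sublocale A_val: inj_idom_hom A_val
  by unfold_locales (simp_all add: A_val_def Fq_poly.hom_add Fq_poly.hom_mult theta_transcendental)

sublocale AX: map_poly_inj_idom_hom A_val ..

text \<open>Coefficients stay in F_q[theta], the setting of \<open>eisenstein\<close>; the
  denominators of K come in later through closure under quotients.\<close>

definition eval2 :: "'c \<Rightarrow> 'f poly poly \<Rightarrow> 'c" where
  "eval2 x g = poly (map_poly A_val g) x"

lemma A_val_theta [simp]: "A_val [:0, 1:] = \<theta>"
  by (simp add: A_val_def)

lemma A_val_K: "A_val a \<in> K_field j"
  unfolding A_val_def by (rule poly_theta_K)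

lemma eval2_const [simp]: "eval2 x [:a:] = A_val a"
  by (simp add: eval2_def hom_distribs)

lemma eval2_X [simp]: "eval2 x [:0, 1:] = x"
  by (simp add: eval2_def hom_distribs)

lemma eval2_1 [simp]: "eval2 x 1 = 1"
  by (simp add: eval2_def)

lemma eval2_add: "eval2 x (g + h) = eval2 x g + eval2 x h"
  and eval2_uminus: "eval2 x (- g) = - eval2 x g"
  and eval2_mult: "eval2 x (g * h) = eval2 x g * eval2 x h"
  and eval2_power: "eval2 x (g ^ n) = eval2 x g ^ n"
  and eval2_smult: "eval2 x (Polynomial.smult a g) = A_val a * eval2 x g"
  by (simp_all add: eval2_def AX.hom_add AX.hom_uminus AX.hom_mult AX.hom_power hom_distribs)

lemma eval2_pcompose: "eval2 x (pcompose g h) = eval2 (eval2 x h) g"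
proof (induction g)
  case (pCons a g)
  have "eval2 y (pCons a g) = A_val a + y * eval2 y g" for y
    by (simp add: eval2_def hom_distribs)
  then show ?case
    using pCons.IH by (simp add: pcompose_pCons eval2_add eval2_mult)
qed (simp add: eval2_def)

text \<open>This describes a generator of the Tate module of the Carlitz module itself: a nonzero
  t-torsion point followed by successive t-division points.\<close>

definition division_seq :: "(nat \<Rightarrow> 'c) \<Rightarrow> bool" where
  "division_seq e \<longleftrightarrow> e 0 \<noteq> 0 \<and> e 0 ^ CARD('f) + \<theta> * e 0 = 0 \<and>
     (\<forall>n. e (Suc n) ^ CARD('f) + \<theta> * e (Suc n) = e n)"

lemma division_seq_mem:
  assumes "division_seq e"
  shows "e n \<in> L"
  by (induction n) (rule torsion_root_mem, use assms in \<open>simp add: division_seq_def\<close>)+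

lemma eval2_torsion_poly:
  assumes "division_seq e"
  shows "eval2 (e (m + n)) (torsion_poly n) = e m"
  by (induction n arbitrary: m)
     (use assms in \<open>auto simp: division_seq_def eval2_add eval2_power eval2_smult
        simp flip: add_Suc add_Suc_shift\<close>)

lemma eval2_primitive_torsion_poly:
  assumes "division_seq e"
  shows "eval2 (e n) (primitive_torsion_poly n) = 0"
proof -
  have "e 0 * (e 0 ^ (CARD('f) - 1) + \<theta>) = 0" "e 0 \<noteq> 0"
    using assms by (simp_all add: division_seq_def power_q_eq distrib_left mult.commute)
  then have "e 0 ^ (CARD('f) - 1) + \<theta> = 0"
    by simp
  then show ?thesis
    using eval2_torsion_poly[OF assms, of 0 n]
    by (simp add: primitive_torsion_poly_def eval2_add eval2_power)
qed

text \<open>Let h be nonzero of least degree vanishing at \<open>e n\<close>. The pseudo-remainder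
  of the Eisenstein polynomial by h is zero by minimality, so h divides a constant multiple of that
  polynomial, and \<open>eisenstein\<close> makes the cofactor constant.\<close>

lemma degree_vanishing:
  assumes e: "division_seq e" and g: "g \<noteq> 0" "eval2 (e n) g = 0"
  shows "degree (primitive_torsion_poly n :: 'f poly poly) \<le> degree g"
proof -
  let ?p = "primitive_torsion_poly n :: 'f poly poly"
  let ?V = "\<lambda>d. \<exists>h. h \<noteq> 0 \<and> eval2 (e n) h = 0 \<and> degree h = d"
  have "?V (degree g)"
    using g by blast
  then have "?V (LEAST d. ?V d)" "(LEAST d. ?V d) \<le> degree g"
    by (rule LeastI, rule Least_le)
  then obtain h where h: "h \<noteq> 0" "eval2 (e n) h = 0" "degree h = (LEAST d. ?V d)"
    by blast
  obtain a s where as: "a \<noteq> 0" "Polynomial.smult a ?p = h * s + pseudo_mod ?p h"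
    using pseudo_mod(1)[OF h(1), of ?p] by blast
  have "eval2 (e n) (pseudo_mod ?p h) = 0"
    using arg_cong[OF as(2), of "eval2 (e n)"] h(2) eval2_primitive_torsion_poly[OF e]
    by (simp add: eval2_add eval2_mult eval2_smult)
  then have "(LEAST d. ?V d) \<le> degree (pseudo_mod ?p h)" if "pseudo_mod ?p h \<noteq> 0"
    using that by (intro Least_le) blast
  then have "pseudo_mod ?p h = 0"
    using pseudo_mod(2)[OF h(1), of ?p] h(3) by linarith
  then have "s * h = Polynomial.smult a ?p"
    using as(2) by (simp add: mult.commute)
  note sh = this
  have "degree h \<noteq> 0"
  proof
    assume "degree h = 0"
    then obtain b where "h = [:b:]"
      by (rule degree_eq_zeroE)
    then show False
      using h(1,2) by simp
  qed
  then have "degree s = 0"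
    using eisenstein[OF primitive_torsion_poly_eisenstein sh as(1)] by simp
  moreover have "?p \<noteq> 0"
    using primitive_torsion_poly_eisenstein(1)[of n, where 'f='f] by auto
  then have "s \<noteq> 0"
    using sh as(1) by auto
  ultimately have "degree h = degree ?p"
    using arg_cong[OF sh, of degree] h(1) as(1) by (simp add: degree_mult_eq)
  then show ?thesis
    using h(3) \<open>(LEAST d. ?V d) \<le> degree g\<close> by simp
qed

text \<open>The pseudo-remainder of \<open>g\<close> by the Eisenstein polynomial vanishes at
  \<open>e n\<close> and has too small a degree, so it is zero. Up to a nonzero constant,
  \<open>g\<close> is then a multiple of a polynomial that vanishes at \<open>e' n\<close> as
  well.\<close>

lemma eval2_zero_transfer:
  assumes e: "division_seq e" and e': "division_seq e'" and g: "eval2 (e n) g = 0"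
  shows "eval2 (e' n) g = 0"
proof -
  let ?p = "primitive_torsion_poly n :: 'f poly poly"
  have "?p \<noteq> 0"
    using primitive_torsion_poly_eisenstein(1)[of n, where 'f='f] by auto
  then obtain a s where as: "a \<noteq> 0" "Polynomial.smult a g = ?p * s + pseudo_mod g ?p"
    and deg: "pseudo_mod g ?p = 0 \<or> degree (pseudo_mod g ?p) < degree ?p"
    using pseudo_mod[of ?p g] by blast
  have "eval2 (e n) (pseudo_mod g ?p) = 0"
    using arg_cong[OF as(2), of "eval2 (e n)"] g eval2_primitive_torsion_poly[OF e]
    by (simp add: eval2_add eval2_mult eval2_smult)
  then have "pseudo_mod g ?p = 0"
    using degree_vanishing[OF e] deg by (metis not_le)
  then have "A_val a * eval2 (e' n) g = 0"
    using arg_cong[OF as(2), of "eval2 (e' n)"] eval2_primitive_torsion_poly[OF e']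
    by (simp add: eval2_add eval2_mult eval2_smult)
  then show ?thesis
    using as(1) by simp
qed

text \<open>In both sequences the lower point is the value of the same torsion polynomial at the
  higher point, so composing with it raises the level.\<close>

lemma eval2_raise_level:
  assumes e: "division_seq e" and e': "division_seq e'" and "n \<le> m"
  shows "\<exists>h. eval2 (e m) h = eval2 (e n) g \<and> eval2 (e' m) h = eval2 (e' n) g"
  using eval2_torsion_poly[OF e, of n "m - n"] eval2_torsion_poly[OF e', of n "m - n"] \<open>n \<le> m\<close>
  by (intro exI[of _ "pcompose g (torsion_poly (m - n))"]) (simp add: eval2_pcompose)

text \<open>The values of one polynomial at \<open>e n\<close> and \<open>e' n\<close>, over all
  levels, form a partial isomorphism: zeros transfer by irreducibility, and sums and products are
  formed at a common level. Its extension to \<open>L\<close> is the required automorphism.\<close>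

theorem Gal_moves_division_seq:
  assumes e: "division_seq e" and e': "division_seq e'"
  obtains \<gamma> where "\<gamma> \<in> carrier (Gal L (K_field j))" "\<And>n. \<gamma> (e n) = e' n"
proof -
  let ?R = "{(eval2 (e n) g, eval2 (e' n) g) |n g. True}"
  have eval2_mem: "eval2 x g \<in> L" if "x \<in> L" for x g
    unfolding eval2_def using that A_val_K K_field_subset
    by (intro poly_mem) (auto simp: A_val.coeff_map_poly_hom)
  have R_I: "(x, y) \<in> ?R" if "x = eval2 (e n) g" "y = eval2 (e' n) g" for x y n g
    using that by blast
  have "partial_iso L ?R"
    unfolding partial_iso_def
  proof (intro conjI allI impI)
    show "?R \<subseteq> L \<times> L"
      using division_seq_mem[OF e] division_seq_mem[OF e'] eval2_mem by auto
    show "(1, 1) \<in> ?R"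
      by (rule R_I[of _ 0 1]) simp_all
    fix x y assume "(x, y) \<in> ?R"
    then obtain n g where xy: "x = eval2 (e n) g" "y = eval2 (e' n) g"
      by blast
    show "(- x, - y) \<in> ?R"
      by (rule R_I[of _ n "- g"]) (simp_all add: xy eval2_uminus)
    show "x = 0 \<longleftrightarrow> y = 0"
      using eval2_zero_transfer[OF e e'] eval2_zero_transfer[OF e' e] by (auto simp: xy)
    fix z w assume "(z, w) \<in> ?R"
    then obtain m h where zw: "z = eval2 (e m) h" "w = eval2 (e' m) h"
      by blast
    obtain g' where g': "eval2 (e (max n m)) g' = x" "eval2 (e' (max n m)) g' = y"
      using eval2_raise_level[OF e e', of n "max n m" g] by (auto simp: xy)
    obtain h' where h': "eval2 (e (max n m)) h' = z" "eval2 (e' (max n m)) h' = w"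
      using eval2_raise_level[OF e e', of m "max n m" h] by (auto simp: zw)
    show "(x + z, y + w) \<in> ?R"
      by (rule R_I[of _ "max n m" "g' + h'"]) (simp_all add: eval2_add g' h')
    show "(x * z, y * w) \<in> ?R"
      by (rule R_I[of _ "max n m" "g' * h'"]) (simp_all add: eval2_mult g' h')
  qed
  moreover have "\<exists>x y. (x, x) \<in> ?R \<and> (y, y) \<in> ?R \<and> y \<noteq> 0 \<and> c = x / y" if c_K: "c \<in> K_field j" for c
  proof -
    obtain p r where c: "c = A_val p / A_val r" "r \<noteq> 0"
      using c_K by (auto simp: K_field_def A_val_def)
    have "(A_val a, A_val a) \<in> ?R" for a
      by (rule R_I[of _ 0 "[:a:]"]) simp_all
    then show ?thesis
      using c by (intro exI[of _ "A_val p"] exI[of _ "A_val r"]) simp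
  qed
  ultimately obtain \<gamma> where \<gamma>: "\<gamma> \<in> carrier (Gal L (K_field j))" "\<And>x y. (x, y) \<in> ?R \<Longrightarrow> \<gamma> x = y"
    using partial_iso_extends_to_Gal[OF Ksep, of ?R] by blast
  have "(e n, e' n) \<in> ?R" for n
    by (rule R_I[of _ n "[:0, 1:]"]) simp_all
  then show ?thesis
    using \<gamma> that by blast
qed

end

section \<open>The character and the representation as group homomorphisms\<close>

context carlitz
begin

abbreviation "G \<equiv> Gal L (K_field j)"
abbreviation "char \<equiv> galois_char j v lam"

lemma carlitz_galI: "\<gamma> \<in> carrier G \<Longrightarrow> carlitz_gal j v L lam \<gamma>"
  by (simp add: carlitz_gal_def carlitz_gal_axioms_def carlitz_axioms)

lemma Gal_Bij: "\<gamma> \<in> carrier G \<Longrightarrow> \<gamma> \<in> Bij L"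
  by (simp add: Gal_def)

lemma Gal_mult:
  assumes "\<gamma> \<in> carrier G" "\<delta> \<in> carrier G"
  shows "\<gamma> \<otimes>\<^bsub>G\<^esub> \<delta> = compose L \<gamma> \<delta>"
proof -
  have "\<gamma> \<otimes>\<^bsub>G\<^esub> \<delta> = \<gamma> \<otimes>\<^bsub>BijGroup L\<^esub> \<delta>"
    by (simp add: Gal_def)
  also have "\<dots> = compose L \<gamma> \<delta>"
    using assms[THEN Gal_Bij] by (simp add: BijGroup_def)
  finally show ?thesis .
qed

lemma Gal_mult_closed:
  assumes "\<gamma> \<in> carrier G" "\<delta> \<in> carrier G"
  shows "\<gamma> \<otimes>\<^bsub>G\<^esub> \<delta> \<in> carrier G"
proof -
  interpret \<gamma>: carlitz_gal j v L lam \<gamma> by (rule carlitz_galI) fact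
  interpret \<delta>: carlitz_gal j v L lam \<delta> by (rule carlitz_galI) fact
  have "compose L \<gamma> \<delta> \<in> Bij L"
    using assms Gal_Bij compose_Bij by blast
  moreover have "compose L \<gamma> \<delta> (x + y) = compose L \<gamma> \<delta> x + compose L \<gamma> \<delta> y"
    "compose L \<gamma> \<delta> (x * y) = compose L \<gamma> \<delta> x * compose L \<gamma> \<delta> y" if "x \<in> L" "y \<in> L" for x y
    using that by (simp_all add: compose_eq add_mem mult_mem \<gamma>.gal_add \<gamma>.gal_mult \<delta>.gal_add
        \<delta>.gal_mult \<delta>.gal_mem)
  moreover have "compose L \<gamma> \<delta> x = x" if "x \<in> K_field j" for x
    using that K_field_subset \<gamma>.gal_fixed \<delta>.gal_fixed by (auto simp: compose_eq)
  ultimately show ?thesis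
    unfolding Gal_mult[OF assms] by (simp add: Gal_def)
qed

text \<open>The first automorphism fixes the F_q-coefficients of the series attached to the second,
  so that series passes through it as a factor.\<close>

lemma char_mult:
  assumes "\<gamma> \<in> carrier G" "\<delta> \<in> carrier G"
  shows "char (\<gamma> \<otimes>\<^bsub>G\<^esub> \<delta>) = char \<gamma> * char \<delta>"
proof -
  interpret \<gamma>: carlitz_gal j v L lam \<gamma> by (rule carlitz_galI) fact
  interpret \<delta>: carlitz_gal j v L lam \<delta> by (rule carlitz_galI) fact
  interpret m: carlitz_gal j v L lam "\<gamma> \<otimes>\<^bsub>G\<^esub> \<delta>"
    by (rule carlitz_galI[OF Gal_mult_closed[OF assms]])
  have "gal_fps (\<gamma> \<otimes>\<^bsub>G\<^esub> \<delta>) omega_t = gal_fps \<gamma> (gal_fps \<delta> omega_t)"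
    by (simp add: Gal_mult[OF assms] gal_fps_def fps_eq_iff compose_eq omega_mem)
  also have "\<dots> = Fq_fps j (char \<gamma> * char \<delta>) * omega_t"
    by (simp add: \<delta>.gal_char \<gamma>.gal_fps_mult Fq_fps_over_L omega_over \<gamma>.gal_Fq_fps \<gamma>.gal_char
        Fq_fps_mult mult_ac)
  finally show ?thesis
    by (rule m.gal_char_unique)
qed

lemma char_hom: "char \<in> hom G fps_units"
  using carlitz_gal.gal_char_unit[OF carlitz_galI] char_mult
  by (simp add: hom_def fps_units_carrier fps_units_mult Pi_def)

text \<open>A series over F_q is fixed by the twist, so u omega solves the equation of omega; a
  nonzero constant term of \<open>u\<close> makes the first coefficient nonzero.\<close>

lemma division_seq_unit:
  assumes "u dvd 1"
  shows "division_seq (\<lambda>n. fps_nth (Fq_fps j u * omega_t) n)"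
proof -
  have "frob.fps_map (Fq_fps j u * omega_t) = t_theta * (Fq_fps j u * omega_t)"
    by (simp only: twist_mult twist_Fq_fps twist_omega mult.left_commute)
  moreover have "fps_nth u 0 \<noteq> 0"
    using assms by (simp add: fps_is_unit_iff)
  ultimately show ?thesis
    by (simp add: twist_eq_iff division_seq_def)
qed

text \<open>An automorphism moving the coefficients of omega to those of u omega has the character
  value \<open>u\<close> by uniqueness.\<close>

lemma char_surj:
  assumes "u dvd 1"
  obtains \<gamma> where "\<gamma> \<in> carrier G" "char \<gamma> = u"
proof -
  have "division_seq (fps_nth omega_t)"
    using division_seq_unit[of 1] by simp
  then obtain \<gamma> where \<gamma>: "\<gamma> \<in> carrier G"
    "\<And>n. \<gamma> (fps_nth omega_t n) = fps_nth (Fq_fps j u * omega_t) n"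
    using Gal_moves_division_seq division_seq_unit[OF assms] by metis
  interpret \<gamma>: carlitz_gal j v L lam \<gamma> by (rule carlitz_galI) fact
  have "gal_fps \<gamma> omega_t = Fq_fps j u * omega_t"
    by (simp only: gal_fps_def \<gamma>(2) fps_nth_inverse)
  then show ?thesis
    using that \<gamma>(1) \<gamma>.gal_char_unique by blast
qed

lemma char_epi: "char \<in> epi G fps_units"
proof -
  have "carrier fps_units \<subseteq> char ` carrier G"
    using char_surj by (auto simp: fps_units_carrier) (metis imageI)
  then show ?thesis
    using char_hom by (auto simp: epi_def hom_def)
qed

lemma tate_rep_char: "\<gamma> \<in> carrier G \<Longrightarrow> tate_rep j k (omega_basis j v lam k) \<gamma> = rho_mat k (char \<gamma>)"
  by (rule carlitz_gal.tate_rep_eq[OF carlitz_galI])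

lemma tate_rep_hom: "tate_rep j k (omega_basis j v lam k) \<in> hom G (GL_fps (k + 1))"
proof -
  have "rho_mat k \<circ> char \<in> hom G (GL_fps (k + 1))"
    using char_hom rho_mat_hom by (rule hom_compose)
  then show ?thesis
    by (simp add: hom_def Pi_def tate_rep_char Gal_mult_closed)
qed

end

theorem theorem6p3:
  fixes j :: "'f::{finite,field} fls alg_closure \<Rightarrow> 'c::field"
    and v :: "'c \<Rightarrow> real"
    and Ksep :: "'c set"
    and lam :: 'c
    and k :: nat
  assumes C_infinity: "is_C_infinity j v"
    and Ksep: "separable_closure (K_field j) Ksep"
    and lam: "lam ^ (CARD('f) - 1) = - theta j"
    and k: "k \<ge> 1"
  defines "G \<equiv> Gal Ksep (K_field j)"
    and "w \<equiv> omega j v lam"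
    and "b \<equiv> omega_basis j v lam k"
    and "a \<equiv> galois_char j v lam"
  shows "(\<forall>e\<in>tate_module j k. \<forall>n. \<forall>i<k + 1. e n $ i \<in> Ksep) \<and>
    (\<forall>\<gamma>\<in>carrier G. \<forall>e\<in>tate_module j k. gal_tate \<gamma> e \<in> tate_module j k) \<and>
    is_tate_basis j k b \<and>
    (\<forall>\<gamma>\<in>carrier G. \<exists>!A. represents j k b \<gamma> A) \<and>
    tate_rep j k b \<in> hom G (GL_fps (k + 1)) \<and>
    (\<forall>\<gamma>\<in>carrier G. \<exists>!u. u dvd 1 \<and> gal_fps \<gamma> w = Fq_fps j u * w) \<and>
    a \<in> epi G fps_units \<and>
    (rho_mat k :: 'f fps \<Rightarrow> 'f fps mat) \<in> hom fps_units (GL_fps (k + 1)) \<and>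
    (\<forall>\<gamma>\<in>carrier G. tate_rep j k b \<gamma> = (rho_mat k \<circ> a) \<gamma>)"
proof -
  interpret carlitz j v Ksep lam
    using C_infinity Ksep lam by unfold_locales
  note gal = carlitz_galI
  have "e n $ i \<in> Ksep" if "e \<in> tate_module j k" "i < k + 1" for e n i
    using tate_module_mem[of e k i n] that by simp
  moreover have "gal_tate \<gamma> e \<in> tate_module j k"
    if "\<gamma> \<in> carrier (Gal Ksep (K_field j))" "e \<in> tate_module j k" for \<gamma> e
    using carlitz_gal.gal_tate_mem[OF gal] that by blast
  moreover have "\<exists>!A. represents j k (omega_basis j v lam k) \<gamma> A"
    if "\<gamma> \<in> carrier (Gal Ksep (K_field j))" for \<gamma>
    using carlitz_gal.represents_iff[OF gal[OF that]] by simp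
  moreover have "\<exists>!u. u dvd 1 \<and> gal_fps \<gamma> (omega j v lam) = Fq_fps j u * omega j v lam"
    if "\<gamma> \<in> carrier (Gal Ksep (K_field j))" for \<gamma>
    using carlitz_gal.gal_omega[OF gal[OF that]] by (simp only: omega_t_def)
  ultimately show ?thesis
    unfolding G_def w_def b_def a_def
    using omega_basis_is_tate_basis tate_rep_hom char_epi rho_mat_hom tate_rep_char by simp
qed

end
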